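(* Let $\Phi:[0,1]\to\mathbb R$ be symmetric about $\tfrac12$, continuous on $[0,1]$, differentiable on $(0,1)$ with $\Phi'$ increasing and continuous on $(0,1)$ and strictly concave on $(0,\tfrac12]$. Let $\omega:[0,\tfrac12]\to\mathbb R$ be continuous with $\omega(\beta)\le\tfrac14$ and $W^{(n)}(\tfrac12,\beta)\le\omega(\beta)$ for all $\beta$ for which $W^{(n)}(\tfrac12,\beta)$ is defined. Then for $\rho\in(0,1)$ and $n\ge1$, $\mathbf{MaxStab}_\Phi(\tfrac12)\le\overline\Upsilon_\rho$, where $$\overline\Upsilon_\rho:=\max_{\beta\in[0,\frac12]}\ \max_{(z_1,z_2)\in\check{\mathcal Z}}\ (1-2p-2q)\Phi(0)+2p\Phi(\tfrac12+\rho z_1)+2q\Phi(\tfrac12+\rho z_2),$$ $$p=\frac{(1-\rho)(1+\rho-4\rho^2\omega(\beta)+2\beta(1+2\rho z_2-\rho^2))}{4(1+2\rho z_1)(1+\rho z_2-\rho z_1-\rho^2)},\quad q=\frac{(1-\rho)(1+\rho-4\rho^2\omega(\beta)-2\beta(1-2\rho z_1-\rho^2))}{4(1-2\rho z_2)(1+\rho z_2-\rho z_1-\rho^2)},$$ and $\check{\mathcal Z}=\{(z_1,z_2):-\frac1{2\rho}\le z_1\le z_2\le\frac1{2\rho},\ 0\le p\le\frac14+\frac\beta2,\ 0\le q\le\frac14-\frac\beta2\}$.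
   Context: $\mathbf X$ uniform on $\{-1,1\}^n$; $\mathbf Y$ obtained by independently flipping each coordinate of $\mathbf X$ with probability $(1-\rho)/2$; $T_\rho f(\mathbf x)=\mathbb E[f(\mathbf Y)\mid\mathbf X=\mathbf x]$; $\mathbf{MaxStab}_\Phi(a)=\max\{\mathbb E[\Phi(T_\rho f(\mathbf X))]:f:\{-1,1\}^n\to\{0,1\},\mathbb Ef(\mathbf X)=a\}$. For $f:\{-1,1\}^n\to\mathbb R$, $\hat f_{\{i\}}=\mathbb E[f(\mathbf X)X_i]$, $\mathbf W_1[f]=\sum_i\hat f_{\{i\}}^2$, and $W^{(n)}(a,\beta):=\max\{\mathbf W_1[f]:f\text{ Boolean},\ \mathbb Ef=a,\ \max_{i}|\hat f_{\{i\}}|=\beta\}$. *)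

theory Defs
  imports "HOL-Analysis.Analysis"
begin

definition cube :: "nat \<Rightarrow> (nat \<Rightarrow> real) set" where
  "cube n = PiE {..<n} (\<lambda>_. {-1, 1})"

definition Ex :: "nat \<Rightarrow> ((nat \<Rightarrow> real) \<Rightarrow> real) \<Rightarrow> real" where
  "Ex n g = (\<Sum>x\<in>cube n. g x) / 2 ^ n"

text \<open>Boolean functions f : {-1,1}^n \<rightarrow> {0,1} (extensional, hence a finite set).\<close>
definition boolfuns :: "nat \<Rightarrow> ((nat \<Rightarrow> real) \<Rightarrow> real) set" where
  "boolfuns n = PiE (cube n) (\<lambda>_. {0, 1})"

text \<open>Noise operator: P(Y = y | X = x) = prod_i (1 + rho x_i y_i)/2, since each coordinate
  is flipped independently with probability (1 - rho)/2.\<close>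
definition noise_op :: "nat \<Rightarrow> real \<Rightarrow> ((nat \<Rightarrow> real) \<Rightarrow> real) \<Rightarrow> (nat \<Rightarrow> real) \<Rightarrow> real" where
  "noise_op n \<rho> f x = (\<Sum>y\<in>cube n. (\<Prod>i<n. (1 + \<rho> * x i * y i) / 2) * f y)"

definition MaxStab :: "nat \<Rightarrow> real \<Rightarrow> (real \<Rightarrow> real) \<Rightarrow> real \<Rightarrow> real" where
  "MaxStab n \<rho> \<Phi> a =
     Max {Ex n (\<lambda>x. \<Phi> (noise_op n \<rho> f x)) | f. f \<in> boolfuns n \<and> Ex n f = a}"

definition fhat1 :: "nat \<Rightarrow> ((nat \<Rightarrow> real) \<Rightarrow> real) \<Rightarrow> nat \<Rightarrow> real" where
  "fhat1 n f i = Ex n (\<lambda>x. f x * x i)"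

definition W1 :: "nat \<Rightarrow> ((nat \<Rightarrow> real) \<Rightarrow> real) \<Rightarrow> real" where
  "W1 n f = (\<Sum>i<n. (fhat1 n f i)\<^sup>2)"

definition maxcoef :: "nat \<Rightarrow> ((nat \<Rightarrow> real) \<Rightarrow> real) \<Rightarrow> real" where
  "maxcoef n f = Max {\<bar>fhat1 n f i\<bar> | i. i < n}"

text \<open>The admissible set for W^(n)(a, beta); W^(n)(a, beta) is defined iff it is nonempty.\<close>
definition Wset :: "nat \<Rightarrow> real \<Rightarrow> real \<Rightarrow> ((nat \<Rightarrow> real) \<Rightarrow> real) set" where
  "Wset n a \<beta> = {f \<in> boolfuns n. Ex n f = a \<and> maxcoef n f = \<beta>}"

definition W :: "nat \<Rightarrow> real \<Rightarrow> real \<Rightarrow> real" where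
  "W n a \<beta> = Max (W1 n ` Wset n a \<beta>)"

definition strictly_concave_on :: "real set \<Rightarrow> (real \<Rightarrow> real) \<Rightarrow> bool" where
  "strictly_concave_on S g \<longleftrightarrow>
     (\<forall>x\<in>S. \<forall>y\<in>S. \<forall>t. x \<noteq> y \<and> 0 < t \<and> t < 1 \<longrightarrow>
        g ((1 - t) * x + t * y) > (1 - t) * g x + t * g y)"

definition pp :: "real \<Rightarrow> real \<Rightarrow> real \<Rightarrow> real \<Rightarrow> real \<Rightarrow> real" where
  "pp \<rho> w \<beta> z1 z2 =
     (1 - \<rho>) * (1 + \<rho> - 4 * \<rho>\<^sup>2 * w + 2 * \<beta> * (1 + 2 * \<rho> * z2 - \<rho>\<^sup>2))
     / (4 * (1 + 2 * \<rho> * z1) * (1 + \<rho> * z2 - \<rho> * z1 - \<rho>\<^sup>2))"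

definition qq :: "real \<Rightarrow> real \<Rightarrow> real \<Rightarrow> real \<Rightarrow> real \<Rightarrow> real" where
  "qq \<rho> w \<beta> z1 z2 =
     (1 - \<rho>) * (1 + \<rho> - 4 * \<rho>\<^sup>2 * w - 2 * \<beta> * (1 - 2 * \<rho> * z1 - \<rho>\<^sup>2))
     / (4 * (1 - 2 * \<rho> * z2) * (1 + \<rho> * z2 - \<rho> * z1 - \<rho>\<^sup>2))"

text \<open>The set Z-check (for given beta, with w = omega(beta)); points where a denominator of
  p or q vanishes are excluded, as p, q are undefined there.\<close>
definition Zcheck :: "real \<Rightarrow> real \<Rightarrow> real \<Rightarrow> (real \<times> real) set" where
  "Zcheck \<rho> w \<beta> = {(z1, z2). - 1 / (2 * \<rho>) \<le> z1 \<and> z1 \<le> z2 \<and> z2 \<le> 1 / (2 * \<rho>)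
      \<and> 1 + 2 * \<rho> * z1 \<noteq> 0 \<and> 1 - 2 * \<rho> * z2 \<noteq> 0
      \<and> 1 + \<rho> * z2 - \<rho> * z1 - \<rho>\<^sup>2 \<noteq> 0
      \<and> 0 \<le> pp \<rho> w \<beta> z1 z2 \<and> pp \<rho> w \<beta> z1 z2 \<le> 1/4 + \<beta>/2
      \<and> 0 \<le> qq \<rho> w \<beta> z1 z2 \<and> qq \<rho> w \<beta> z1 z2 \<le> 1/4 - \<beta>/2}"

definition Upsilon_bar :: "real \<Rightarrow> (real \<Rightarrow> real) \<Rightarrow> (real \<Rightarrow> real) \<Rightarrow> real" where
  "Upsilon_bar \<rho> \<Phi> \<omega> =
     Sup {(1 - 2 * pp \<rho> (\<omega> \<beta>) \<beta> z1 z2 - 2 * qq \<rho> (\<omega> \<beta>) \<beta> z1 z2) * \<Phi> 0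
          + 2 * pp \<rho> (\<omega> \<beta>) \<beta> z1 z2 * \<Phi> (1/2 + \<rho> * z1)
          + 2 * qq \<rho> (\<omega> \<beta>) \<beta> z1 z2 * \<Phi> (1/2 + \<rho> * z2)
        | \<beta> z1 z2. \<beta> \<in> {0..1/2} \<and> (z1, z2) \<in> Zcheck \<rho> (\<omega> \<beta>) \<beta>}"

end

theory Submission
  imports Defs
begin

text \<open>
  Let \<open>f\<close> be Boolean with mean 1/2, \<open>g = T f\<close> and \<open>h = |f - g|\<close>, so \<open>\<Phi> g = \<Phi> h\<close> by symmetry. Split the
  cube according to whether \<open>(2 f - 1) x_i = \<plusminus>1\<close>, where \<open>i\<close> carries the largest first-level coefficient
  \<open>\<beta>\<close> (up to sign). The two cells have masses \<open>1/2 \<plusminus> \<beta>\<close>, the integrals of \<open>h\<close> over them differ by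
  \<open>(1 - \<rho>) \<beta>\<close>, and \<open>2 E[h (1 - h)] - \<rho>^2 E[h] \<ge> (1 - \<rho>) (1 + \<rho> - 4 \<rho>^2 \<omega>(\<beta>)) / 2\<close> by a Fourier
  expansion in which only the levels 0 and 1 matter. It remains to maximise \<open>E[\<Phi> h]\<close> under these
  three moment conditions. For \<open>u \<le> 1/2\<close> the quadratic through \<open>(0, \<Phi> 0)\<close> that touches \<open>\<Phi>\<close> at \<open>u\<close>
  dominates \<open>\<Phi>\<close> on [0,1], so that a cell can be replaced by atoms at 0 and \<open>u\<close>; exchanging mass
  between the cells brings every configuration to the two-atom form defining \<open>Upsilon_bar\<close>.
\<close>

subsection \<open>Noise moments on the cube\<close>

lemma finite_cube [simp]: "finite (cube n)"
  unfolding cube_def by (intro finite_PiE) auto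

lemma cube_coord: "x \<in> cube n \<Longrightarrow> i < n \<Longrightarrow> x i = 1 \<or> x i = -1"
  unfolding cube_def by (auto simp: PiE_iff)

lemma Ex_add: "Ex n (\<lambda>x. f x + g x) = Ex n f + Ex n g"
  by (simp add: Ex_def sum.distrib add_divide_distrib)

lemma Ex_diff: "Ex n (\<lambda>x. f x - g x) = Ex n f - Ex n g"
  by (simp add: Ex_def sum_subtractf diff_divide_distrib)

lemma Ex_cmult: "Ex n (\<lambda>x. c * f x) = c * Ex n f"
  by (simp add: Ex_def sum_distrib_left)

lemma Ex_sum: "Ex n (\<lambda>x. \<Sum>S\<in>I. f S x) = (\<Sum>S\<in>I. Ex n (f S))"
  unfolding Ex_def by (subst sum.swap) (simp add: sum_divide_distrib)

lemma Ex_cong: "(\<And>x. x \<in> cube n \<Longrightarrow> f x = g x) \<Longrightarrow> Ex n f = Ex n g"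
  unfolding Ex_def by (metis sum.cong)

lemma Ex_mono: "(\<And>x. x \<in> cube n \<Longrightarrow> f x \<le> g x) \<Longrightarrow> Ex n f \<le> Ex n g"
  unfolding Ex_def by (intro divide_right_mono sum_mono) auto

text \<open>Distributivity over the product structure of the cube; total mass, orthogonality of
  characters and normalisation of the noise kernel all reduce to it.\<close>

lemma sum_cube_prod:
  "(\<Sum>x\<in>cube n. \<Prod>i<n. F i (x i)) = (\<Prod>i<n. F i (-1) + F i (1::real) :: real)"
proof -
  have "(\<Sum>x\<in>cube n. \<Prod>i<n. F i (x i)) = (\<Prod>i<n. \<Sum>a\<in>{-1, 1}. F i a)"
    unfolding cube_def by (rule prod_sum_PiE[symmetric]) auto
  then show ?thesis by simp
qed

lemma Ex_const: "Ex n (\<lambda>x. c) = c"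
proof -
  have "(\<Sum>x\<in>cube n. 1::real) = 2 ^ n"
    using sum_cube_prod[where F = "\<lambda>_ _. 1" and n = n] by simp
  then show ?thesis using Ex_cmult[of n c "\<lambda>_. 1"] by (simp add: Ex_def)
qed

section \<open>Walsh-Fourier expansion of the noise operator\<close>

definition char_fun :: "nat set \<Rightarrow> (nat \<Rightarrow> real) \<Rightarrow> real" where
  "char_fun S x = (\<Prod>i\<in>S. x i)"

definition fcoef :: "nat \<Rightarrow> ((nat \<Rightarrow> real) \<Rightarrow> real) \<Rightarrow> nat set \<Rightarrow> real" where
  "fcoef n f S = Ex n (\<lambda>x. f x * char_fun S x)"

lemma char_fun_conv: "S \<subseteq> {..<n} \<Longrightarrow> char_fun S x = (\<Prod>i<n. if i \<in> S then x i else 1)"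
  unfolding char_fun_def by (simp add: prod.If_cases Int_absorb1)

text \<open>A coordinate in exactly one of \<open>S\<close>, \<open>T\<close> contributes the factor
  -1 + 1 = 0, every other coordinate the factor 2.\<close>

lemma char_fun_orthonormal:
  assumes "S \<subseteq> {..<n}" "T \<subseteq> {..<n}"
  shows "Ex n (\<lambda>x. char_fun S x * char_fun T x) = (if S = T then 1 else 0)"
proof -
  define F :: "nat \<Rightarrow> real \<Rightarrow> real"
    where "F i a = (if i \<in> S then a else 1) * (if i \<in> T then a else 1)" for i a
  have "(\<Sum>x\<in>cube n. char_fun S x * char_fun T x) = (\<Prod>i<n. F i (-1) + F i 1)"
    unfolding sum_cube_prod[symmetric] using assms
    by (simp add: char_fun_conv F_def prod.distrib)
  also have "\<dots> = (\<Prod>i<n. if i \<in> S \<longleftrightarrow> i \<in> T then 2 else 0)"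
    by (rule prod.cong) (auto simp: F_def)
  also have "\<dots> = (if S = T then 2 ^ n else 0)"
  proof (cases "S = T")
    case False
    then obtain i where "i < n" "(i \<in> S) \<noteq> (i \<in> T)" using assms by blast
    then show ?thesis using False by (auto intro!: prod_zero)
  qed simp
  finally show ?thesis by (simp add: Ex_def)
qed

text \<open>Expanding the product kernel yields one character per subset of coordinates, so
  characters are eigenfunctions with eigenvalue \<open>\<rho> ^ card S\<close>.\<close>

lemma noise_op_fourier:
  "noise_op n \<rho> f x = (\<Sum>S\<in>Pow {..<n}. \<rho> ^ card S * fcoef n f S * char_fun S x)"
proof -
  have ker: "(\<Prod>i<n. (1 + \<rho> * x i * y i) / 2)
      = (\<Sum>S\<in>Pow {..<n}. \<rho> ^ card S * char_fun S x * char_fun S y) / 2 ^ n" for y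
  proof -
    have "(\<Prod>i<n. (1 + \<rho> * x i * y i) / 2) = (\<Prod>i<n. \<rho> * x i * y i + 1) / 2 ^ n"
      by (simp add: prod_dividef add.commute)
    also have "(\<Prod>i<n. \<rho> * x i * y i + 1) = (\<Sum>S\<in>Pow {..<n}. \<rho> ^ card S * char_fun S x * char_fun S y)"
      unfolding char_fun_def by (subst prod_add) (auto simp: prod.distrib)
    finally show ?thesis .
  qed
  show ?thesis
    unfolding noise_op_def ker fcoef_def Ex_def
    by (simp add: sum_distrib_left sum_distrib_right sum_divide_distrib)
      (subst sum.swap, simp add: mult_ac)
qed

text \<open>The operator averages against a probability kernel: each factor is nonnegative and sums
  to 1 over the two values of \<open>y i\<close>.\<close>

lemma noise_op_range:
  assumes f: "\<And>y. y \<in> cube n \<Longrightarrow> 0 \<le> f y \<and> f y \<le> 1" and x: "x \<in> cube n" and "0 \<le> \<rho>" "\<rho> \<le> 1"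
  shows "0 \<le> noise_op n \<rho> f x" "noise_op n \<rho> f x \<le> 1"
proof -
  have k: "0 \<le> (\<Prod>i<n. (1 + \<rho> * x i * y i) / 2)" if "y \<in> cube n" for y
  proof (rule prod_nonneg)
    fix i assume "i \<in> {..<n}"
    then show "0 \<le> (1 + \<rho> * x i * y i) / 2"
      using cube_coord[OF x, of i] cube_coord[OF that, of i] assms by auto
  qed
  have "(\<Sum>y\<in>cube n. \<Prod>i<n. (1 + \<rho> * x i * y i) / 2)
      = (\<Prod>i<n. (1 + \<rho> * x i * (-1)) / 2 + (1 + \<rho> * x i * 1) / 2)"
    by (rule sum_cube_prod)
  also have "\<dots> = 1" by (rule prod.neutral) (simp add: field_simps)
  finally have tot: "(\<Sum>y\<in>cube n. \<Prod>i<n. (1 + \<rho> * x i * y i) / 2) = 1" .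
  show "0 \<le> noise_op n \<rho> f x" unfolding noise_op_def using k f by (auto intro!: sum_nonneg)
  have "noise_op n \<rho> f x \<le> (\<Sum>y\<in>cube n. \<Prod>i<n. (1 + \<rho> * x i * y i) / 2)"
    unfolding noise_op_def using k f by (intro sum_mono mult_left_le) auto
  then show "noise_op n \<rho> f x \<le> 1" using tot by simp
qed

lemma fcoef_noise_op:
  assumes "S \<subseteq> {..<n}"
  shows "fcoef n (noise_op n \<rho> f) S = \<rho> ^ card S * fcoef n f S"
proof -
  have "fcoef n (noise_op n \<rho> f) S
      = (\<Sum>T\<in>Pow {..<n}. \<rho> ^ card T * fcoef n f T * Ex n (\<lambda>x. char_fun T x * char_fun S x))"
    unfolding fcoef_def[of n "noise_op n \<rho> f"] noise_op_fourier sum_distrib_right Ex_sum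
    by (simp add: Ex_cmult[symmetric] mult.assoc)
  also have "\<dots> = (\<Sum>T\<in>Pow {..<n}. if T = S then \<rho> ^ card S * fcoef n f S else 0)"
    using assms by (intro sum.cong) (auto simp: char_fun_orthonormal)
  also have "\<dots> = \<rho> ^ card S * fcoef n f S" using assms by (simp add: sum.delta)
  finally show ?thesis .
qed

text \<open>With \<open>g\<close> left free this covers both the correlation of \<open>f\<close>
  with its noisy version and, for \<open>g = noise_op n \<rho> f\<close>, the second moment of the
  latter.\<close>

lemma Ex_mult_noise_op:
  "Ex n (\<lambda>x. g x * noise_op n \<rho> f x)
    = (\<Sum>S\<in>Pow {..<n}. \<rho> ^ card S * fcoef n f S * fcoef n g S)"
proof -
  have "Ex n (\<lambda>x. g x * noise_op n \<rho> f x)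
      = Ex n (\<lambda>x. \<Sum>S\<in>Pow {..<n}. \<rho> ^ card S * fcoef n f S * (g x * char_fun S x))"
    unfolding noise_op_fourier sum_distrib_left by (simp add: mult_ac)
  then show ?thesis by (simp add: Ex_sum Ex_cmult fcoef_def)
qed

lemma fcoef_singleton: "fcoef n f {i} = fhat1 n f i"
  by (simp add: fcoef_def fhat1_def char_fun_def)

lemma fcoef_empty: "fcoef n f {} = Ex n f"
  by (simp add: fcoef_def char_fun_def)

text \<open>The coefficient \<open>\<rho> ^ (k + 2) - \<rho> ^ (2 * k)\<close> of the weight at level \<open>k\<close> vanishes for
  \<open>k = 2\<close> and is nonnegative for \<open>k > 2\<close>, so only the levels 0 and 1 count.\<close>

lemma noise_moment_bound:
  assumes "0 < \<rho>" "\<rho> < 1"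
  shows "(\<rho>\<^sup>2 - 1) * (Ex n f)\<^sup>2 - \<rho>\<^sup>2 * (1 - \<rho>) * W1 n f
    \<le> \<rho>\<^sup>2 * Ex n (\<lambda>x. f x * noise_op n \<rho> f x) - Ex n (\<lambda>x. (noise_op n \<rho> f x)\<^sup>2)"
proof -
  define c where "c S = (\<rho>\<^sup>2 * \<rho> ^ card S - (\<rho> ^ card S)\<^sup>2) * (fcoef n f S)\<^sup>2" for S
  define U where "U = (\<lambda>i. {i}) ` {..<n}"
  have "\<rho>\<^sup>2 * Ex n (\<lambda>x. f x * noise_op n \<rho> f x) - Ex n (\<lambda>x. (noise_op n \<rho> f x)\<^sup>2) = sum c (Pow {..<n})"
    unfolding power2_eq_square[of "noise_op _ _ _ _"] Ex_mult_noise_op c_def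
    by (simp add: fcoef_noise_op sum_distrib_left sum_subtractf[symmetric] algebra_simps power2_eq_square)
  moreover have "sum c (insert {} U) \<le> sum c (Pow {..<n})"
  proof (rule sum_mono2)
    fix S assume S: "S \<in> Pow {..<n} - insert {} U"
    then have fin: "finite S" using finite_subset by blast
    have "card S \<noteq> 0" using S fin by auto
    moreover have "card S \<noteq> 1"
    proof
      assume "card S = 1"
      then obtain i where "S = {i}" by (auto simp: card_1_singleton_iff)
      then show False using S by (auto simp: U_def)
    qed
    ultimately have "2 \<le> card S" by linarith
    then have "\<rho> ^ card S \<le> \<rho>\<^sup>2" using assms by (intro power_decreasing) auto
    then have "\<rho> ^ card S * \<rho> ^ card S \<le> \<rho>\<^sup>2 * \<rho> ^ card S" using assms by (intro mult_right_mono) auto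
    then show "0 \<le> c S" unfolding c_def by (simp add: power2_eq_square)
  qed (auto simp: U_def)
  moreover have "sum c (insert {} U) = (\<rho>\<^sup>2 - 1) * (Ex n f)\<^sup>2 - \<rho>\<^sup>2 * (1 - \<rho>) * W1 n f"
  proof -
    have "sum c U = (\<Sum>i<n. (\<rho>\<^sup>2 * \<rho> - \<rho>\<^sup>2) * (fhat1 n f i)\<^sup>2)"
      unfolding U_def by (subst sum.reindex) (auto simp: inj_on_def c_def fcoef_singleton)
    also have "\<dots> = - \<rho>\<^sup>2 * (1 - \<rho>) * W1 n f"
      unfolding W1_def sum_distrib_left[symmetric] by (simp add: algebra_simps)
    finally have "sum c U = - \<rho>\<^sup>2 * (1 - \<rho>) * W1 n f" .
    moreover have "{} \<notin> U" "finite U" by (auto simp: U_def)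
    ultimately show ?thesis by (simp add: c_def fcoef_empty)
  qed
  ultimately show ?thesis by simp
qed

subsection \<open>Quadratic minorants of the loss\<close>

text \<open>The role of \<open>D\<close> is played by \<open>\<Phi> 0 - \<Phi> h\<close>.\<close>

locale loss =
  fixes D :: "real \<Rightarrow> real"
  assumes zero: "D 0 = 0"
    and sym: "0 \<le> h \<Longrightarrow> h \<le> 1 \<Longrightarrow> D (1 - h) = D h"
    and nonneg: "0 \<le> h \<Longrightarrow> h \<le> 1 \<Longrightarrow> 0 \<le> D h"
    and minorant: "0 < u \<Longrightarrow> u \<le> 1/2 \<Longrightarrow>
      \<exists>a b. D u = a * u + b * u\<^sup>2 \<and> (\<forall>h\<in>{0..1}. a * h + b * h\<^sup>2 \<le> D h)"
begin

text \<open>At 1 the quadratic takes the value \<open>a + b\<close> and lies below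
  \<open>D 1 = 0\<close>. A positive \<open>b\<close> would then make \<open>a + b * u\<close>, and
  so \<open>D u\<close>, negative.\<close>

lemma minorant_coeffs:
  assumes "0 < u" "u \<le> 1/2" "D u = a * u + b * u\<^sup>2" "\<forall>h\<in>{0..1}. a * h + b * h\<^sup>2 \<le> D h"
  shows "a + b \<le> 0" "b \<le> 0"
proof -
  have "D 1 = 0" using sym[of 0] zero by simp
  then show ab: "a + b \<le> 0" using assms(4)[rule_format, of 1] by simp
  show "b \<le> 0"
  proof (rule ccontr)
    assume "\<not> b \<le> 0"
    then have "b * u < b" using assms by simp
    then have "a + b * u < 0" using ab by linarith
    then have "u * (a + b * u) < 0" using assms(1) by (simp add: mult_pos_neg)
    moreover have "0 \<le> D u" using nonneg[of u] assms by simp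
    ultimately show False using assms(3) by (simp add: algebra_simps power2_eq_square)
  qed
qed

text \<open>Divided by \<open>h\<close>, the quadratic touching at \<open>u'\<close> becomes a line
  of slope \<open>b \<le> 0\<close> that lies below \<open>D h / h\<close> and meets it at
  \<open>u'\<close>.\<close>

lemma slope_antimono:
  assumes "0 < u" "u \<le> u'" "u' \<le> 1/2"
  shows "D u' / u' \<le> D u / u"
proof -
  obtain a b where ab: "D u' = a * u' + b * u'\<^sup>2" "\<forall>h\<in>{0..1}. a * h + b * h\<^sup>2 \<le> D h"
    using minorant[of u'] assms by auto
  have "b \<le> 0" using minorant_coeffs(2)[of u'] ab assms by auto
  have "D u' / u' = a + b * u'" using ab(1) assms by (simp add: field_simps power2_eq_square)
  also have "\<dots> \<le> a + b * u" using assms \<open>b \<le> 0\<close> by (simp add: mult_left_mono_neg)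
  also have "\<dots> \<le> D u / u"
    using ab(2)[rule_format, of u] assms by (simp add: field_simps power2_eq_square)
  finally show ?thesis .
qed

text \<open>The same division gives a supporting line at every point.\<close>

lemma slope_convex: "convex_on {0<..1/2} (\<lambda>u. D u / u)"
proof (rule convex_onI)
  fix t x y :: real
  assume t: "0 < t" "t < 1" and xy: "x \<in> {0<..1/2}" "y \<in> {0<..1/2}"
  define z where "z = (1 - t) * x + t * y"
  have z: "z \<in> {0<..1/2}"
    using convexD_alt[of "{0<..1/2::real}" x y t] xy t by (simp add: z_def)
  obtain a b where ab: "D z = a * z + b * z\<^sup>2" "\<forall>h\<in>{0..1}. a * h + b * h\<^sup>2 \<le> D h"
    using minorant[of z] z by auto
  have "a + b * x \<le> D x / x" "a + b * y \<le> D y / y"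
    using ab(2)[rule_format, of x] ab(2)[rule_format, of y] xy
    by (auto simp: field_simps power2_eq_square)
  then have "(1 - t) * (a + b * x) + t * (a + b * y) \<le> (1 - t) * (D x / x) + t * (D y / y)"
    using t by (intro add_mono mult_left_mono) auto
  moreover have "D z / z = a + b * z" using ab(1) z by (simp add: field_simps power2_eq_square)
  moreover have "(1 - t) * (a + b * x) + t * (a + b * y) = a + b * z"
    by (simp add: z_def algebra_simps)
  ultimately show "D ((1 - t) *\<^sub>R x + t *\<^sub>R y) / ((1 - t) *\<^sub>R x + t *\<^sub>R y)
      \<le> (1 - t) * (D x / x) + t * (D y / y)"
    by (simp add: z_def)
qed auto

text \<open>Divided by \<open>h * (1 - h)\<close>, the touching quadratic becomes
  \<open>(a + b * h) / (1 - h)\<close>, which is antitone because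
  \<open>a + b \<le> 0\<close>.\<close>

lemma ratio_antimono:
  assumes "0 < u" "u \<le> u'" "u' \<le> 1/2"
  shows "D u' / (u' * (1 - u')) \<le> D u / (u * (1 - u))"
proof -
  obtain a b where ab: "D u' = a * u' + b * u'\<^sup>2" "\<forall>h\<in>{0..1}. a * h + b * h\<^sup>2 \<le> D h"
    using minorant[of u'] assms by auto
  have "a + b \<le> 0" using minorant_coeffs(1)[of u'] ab assms by auto
  then have "(a + b) * (u' - u) \<le> 0" using assms by (simp add: mult_nonpos_nonneg)
  then have *: "(a + b * u') * (1 - u) \<le> (a + b * u) * (1 - u')" by (simp add: algebra_simps)
  have "D u' / (u' * (1 - u')) = (a + b * u') / (1 - u')"
    using ab(1) assms by (simp add: field_simps power2_eq_square)
  also have "\<dots> \<le> (a + b * u) / (1 - u)"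
    using * assms by (simp add: divide_simps mult.commute)
  also have "\<dots> = (a * u + b * u\<^sup>2) / (u * (1 - u))"
    using assms by (simp add: divide_simps) (simp add: algebra_simps power2_eq_square)
  also have "\<dots> \<le> D u / (u * (1 - u))"
    using ab(2)[rule_format, of u] assms by (intro divide_right_mono) auto
  finally show ?thesis .
qed

text \<open>On the left half this compares \<open>h\<close> with 1/2 by
  \<open>ratio_antimono\<close>; symmetry gives the rest.\<close>

lemma half_minorant:
  assumes "0 \<le> h" "h \<le> 1"
  shows "4 * h * (1 - h) * D (1/2) \<le> D h"
proof -
  have *: "4 * h * (1 - h) * D (1/2) \<le> D h" if "0 \<le> h" "h \<le> 1/2" for h
  proof (cases "h = 0")
    case False
    then have "D (1/2) / (1/2 * (1 - 1/2)) \<le> D h / (h * (1 - h))"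
      using ratio_antimono[of h "1/2"] that by simp
    then show ?thesis using that False by (simp add: field_simps)
  qed (simp add: zero)
  show ?thesis
    using *[of h] *[of "1 - h"] sym[of h] assms by (cases "h \<le> 1/2") (auto simp: algebra_simps)
qed

text \<open>Any distribution of values can be replaced by one atom, with the remaining mass at 0,
  keeping the first two moments. The assumption puts the atom in the left half, where the quadratic
  touching there bounds the loss from below.\<close>

lemma atomic_moments:
  assumes "finite I" and k: "\<And>x. x \<in> I \<Longrightarrow> 0 \<le> k x"
    and h: "\<And>x. x \<in> I \<Longrightarrow> 0 \<le> h x \<and> h x \<le> 1"
    and le: "(\<Sum>x\<in>I. k x * h x) \<le> 2 * (\<Sum>x\<in>I. k x * (h x * (1 - h x)))"
  shows "\<exists>\<alpha> u. 0 < u \<and> u \<le> 1/2 \<and> 0 \<le> \<alpha> \<and> \<alpha> \<le> sum k I \<and> \<alpha> * u = (\<Sum>x\<in>I. k x * h x)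
    \<and> \<alpha> * u * (1 - u) = (\<Sum>x\<in>I. k x * (h x * (1 - h x))) \<and> \<alpha> * D u \<le> (\<Sum>x\<in>I. k x * D (h x))"
proof -
  define P m s where "P = sum k I" and "m = (\<Sum>x\<in>I. k x * h x)" and "s = (\<Sum>x\<in>I. k x * (h x)\<^sup>2)"
  have e: "(\<Sum>x\<in>I. k x * (h x * (1 - h x))) = m - s"
    by (simp add: m_def s_def sum_subtractf[symmetric] algebra_simps power2_eq_square)
  have nn: "0 \<le> P" "0 \<le> m" "0 \<le> s"
    unfolding P_def m_def s_def using k h by (auto intro!: sum_nonneg)
  have Dn: "0 \<le> (\<Sum>x\<in>I. k x * D (h x))" using k h nonneg by (auto intro!: sum_nonneg)
  have le': "2 * s \<le> m" using le unfolding e m_def[symmetric] by simp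
  show ?thesis
  proof (cases "m = 0")
    case True
    then have "s = 0" using le' nn by simp
    \<comment> \<open>An empty atom at the arbitrary position 1/2.\<close>
    then show ?thesis
      unfolding e m_def[symmetric] P_def[symmetric] using True Dn nn
      by (intro exI[of _ 0] exI[of _ "1/2"]) auto
  next
    case False
    then have m: "0 < m" using nn by simp
    have "s \<noteq> 0"
    proof
      assume "s = 0"
      then have "\<forall>x\<in>I. k x * (h x)\<^sup>2 = 0"
        unfolding s_def using k \<open>finite I\<close> by (subst (asm) sum_nonneg_eq_0_iff) auto
      then have "m = 0" unfolding m_def by (intro sum.neutral) auto
      then show False using m by simp
    qed
    then have s: "0 < s" using nn by simp
    \<comment> \<open>Position and mass \<open>m / u\<close> are forced by the two moments.\<close>
    define u where "u = s / m"
    have u: "0 < u" "u \<le> 1/2" "u * m = s" using s m le' by (auto simp: u_def field_simps)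
    \<comment> \<open>Cauchy-Schwarz, read off from the second moment about \<open>u\<close>: the
      atom fits into the available mass.\<close>
    have "0 \<le> (\<Sum>x\<in>I. k x * (h x - u)\<^sup>2)" using k by (auto intro!: sum_nonneg)
    also have "\<dots> = (\<Sum>x\<in>I. k x * (h x)\<^sup>2 - 2 * u * (k x * h x) + u\<^sup>2 * k x)"
      by (rule sum.cong) (auto simp: power2_diff algebra_simps)
    also have "\<dots> = s - 2 * u * m + u\<^sup>2 * P"
      by (simp add: s_def m_def P_def sum.distrib sum_subtractf sum_distrib_left)
    finally have "u * m \<le> u * (u * P)" using u(3) by (simp add: power2_eq_square)
    then have mP: "m / u \<le> P" using u(1) by (simp add: field_simps)
    obtain a b where ab: "D u = a * u + b * u\<^sup>2" "\<forall>h\<in>{0..1}. a * h + b * h\<^sup>2 \<le> D h"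
      using minorant[of u] u by auto
    have "m / u * D u = a * m + b * s"
      using u by (simp add: ab(1) field_simps power2_eq_square)
    also have "\<dots> = (\<Sum>x\<in>I. k x * (a * h x + b * (h x)\<^sup>2))"
      unfolding s_def m_def
      by (simp add: sum_distrib_left sum.distrib[symmetric] algebra_simps)
    also have "\<dots> \<le> (\<Sum>x\<in>I. k x * D (h x))"
      using ab(2) k h by (intro sum_mono mult_left_mono) auto
    finally have L: "m / u * D u \<le> (\<Sum>x\<in>I. k x * D (h x))" .
    show ?thesis
      unfolding e m_def[symmetric] P_def[symmetric]
      using u m mP L
      by - (rule exI[of _ "m / u"], rule exI[of _ u], auto simp: right_diff_distrib)
  qed
qed

end

section \<open>Touching quadratics from a convex derivative\<close>

lemma convex_on_chord:
  fixes K :: "real \<Rightarrow> real"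
  assumes "convex_on S K" "{a..c} \<subseteq> S" "a \<le> b" "b \<le> c" "a < c"
  shows "(c - a) * K b \<le> (c - b) * K a + (b - a) * K c"
proof -
  have "K b \<le> (K c - K a) / (c - a) * (b - a) + K a"
    using convex_onD_Icc'[OF convex_on_subset[OF assms(1,2)], of b] assms by simp
  then have "(c - a) * K b \<le> (c - a) * ((K c - K a) / (c - a) * (b - a) + K a)"
    using assms by (intro mult_left_mono) auto
  also have "\<dots> = (K c - K a) * (b - a) + (c - a) * K a"
    using assms by (simp add: distrib_left)
  finally show ?thesis by (simp add: algebra_simps)
qed

text \<open>Chords through the two zeros fix the sign pattern plus, minus, plus. It will be applied
  to the derivative of the gap between \<open>D\<close> and a quadratic.\<close>

lemma convex_on_sign:
  fixes K :: "real \<Rightarrow> real"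
  assumes conv: "convex_on {l<..r} K" and "K v = 0" "K u = 0" "l < v" "v < u" "u \<le> r"
  shows "l < x \<Longrightarrow> x \<le> v \<Longrightarrow> 0 \<le> K x" "v \<le> x \<Longrightarrow> x \<le> u \<Longrightarrow> K x \<le> 0"
    "u \<le> x \<Longrightarrow> x \<le> r \<Longrightarrow> 0 \<le> K x"
proof -
  have sub: "{a..b} \<subseteq> {l<..r}" if "l < a" "b \<le> r" for a b using that by auto
  show "0 \<le> K x" if "l < x" "x \<le> v"
    using convex_on_chord[OF conv, of x u v] sub[of x u] assms that by (auto simp: zero_le_mult_iff)
  show "K x \<le> 0" if "v \<le> x" "x \<le> u"
    using convex_on_chord[OF conv, of v u x] sub[of v u] assms that by (auto simp: mult_le_0_iff)
  show "0 \<le> K x" if "u \<le> x" "x \<le> r"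
    using convex_on_chord[OF conv, of v x u] sub[of v x] assms that by (auto simp: zero_le_mult_iff)
qed

text \<open>The gap \<psi> between \<open>D\<close> and the quadratic tangent at \<open>u\<close>
  vanishes at 0 and \<open>u\<close>, so its derivative vanishes at some \<open>v\<close> in
  between, by Rolle, and at \<open>u\<close>, by tangency. Being convex, that derivative has no
  further sign changes, and \<psi> rises, falls back to 0 and rises again on the left half.\<close>

lemma loss_of_deriv:
  fixes D K :: "real \<Rightarrow> real"
  assumes zero: "D 0 = 0" and sym: "\<And>h. 0 \<le> h \<Longrightarrow> h \<le> 1 \<Longrightarrow> D (1 - h) = D h"
    and cont: "continuous_on {0..1} D"
    and der: "\<And>x. 0 < x \<Longrightarrow> x < 1 \<Longrightarrow> (D has_real_derivative K x) (at x)"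
    and K_half: "K (1/2) = 0" and K_nonneg: "\<And>x. 0 < x \<Longrightarrow> x \<le> 1/2 \<Longrightarrow> 0 \<le> K x"
    and conv: "convex_on {0<..1/2} K"
  shows "loss D"
proof
  have lower: "0 \<le> D h" if "0 \<le> h" "h \<le> 1/2" for h
  proof -
    have "D 0 \<le> D h"
    proof (rule DERIV_nonneg_imp_increasing_open[of 0 h D])
      show "\<exists>y. (D has_real_derivative y) (at x) \<and> 0 \<le> y" if "0 < x" "x < h" for x
        using der[of x] K_nonneg[of x] that \<open>h \<le> 1/2\<close> by (intro exI[of _ "K x"]) auto
      show "continuous_on {0..h} D" using that by (intro continuous_on_subset[OF cont]) auto
    qed (use that in auto)
    then show ?thesis using zero by simp
  qed
  show "0 \<le> D h" if "0 \<le> h" "h \<le> 1" for h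
    using lower[of h] lower[of "1 - h"] sym[of h] that by (cases "h \<le> 1/2") auto
  fix u :: real assume u: "0 < u" "u \<le> 1/2"
  \<comment> \<open>The coefficients solve the two tangency conditions at \<open>u\<close>, for
    value and slope.\<close>
  define b where "b = (u * K u - D u) / u\<^sup>2"
  define a where "a = (2 * D u - u * K u) / u"
  have Du: "D u = a * u + b * u\<^sup>2" and Ku: "K u = a + 2 * b * u"
    using u by (simp_all add: a_def b_def field_simps power2_eq_square)
  have ab: "a + b \<le> 0"
  proof -
    have "u * (1 - u) * K u \<le> (1 - 2 * u) * D u"
    proof (cases "u = 1/2")
      case True
      show ?thesis unfolding True K_half by simp
    next
      case False
      then have u2: "u < 1/2" using u by simp
      \<comment> \<open>Up to the factor \<open>1 - 2 * u\<close>, this subtracts from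
        \<open>D\<close> the multiple of \<open>t * (1 - t)\<close> with the same slope at
        \<open>u\<close>. The chord of \<open>K\<close> from \<open>t\<close> to its zero 1/2 makes
        the derivative nonnegative.\<close>
      define \<theta> where "\<theta> t = (1 - 2 * u) * D t - K u * (t * (1 - t))" for t
      have "\<theta> 0 \<le> \<theta> u"
      proof (rule DERIV_nonneg_imp_increasing_open[of 0 u \<theta>])
        show "continuous_on {0..u} \<theta>"
          unfolding \<theta>_def using u
          by (intro continuous_intros continuous_on_subset[OF cont]) auto
        fix t assume t: "0 < t" "t < u"
        have "(\<theta> has_real_derivative (1 - 2 * u) * K t - K u * (1 - 2 * t)) (at t)"
          unfolding \<theta>_def using der[of t] t u
          by (auto intro!: derivative_eq_intros)
        moreover have "(1/2 - t) * K u \<le> (1/2 - u) * K t + (u - t) * K (1/2)"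
          using t u2 by (intro convex_on_chord[OF conv]) auto
        then have "0 \<le> (1 - 2 * u) * K t - K u * (1 - 2 * t)" using K_half by (simp add: algebra_simps)
        ultimately show "\<exists>y. (\<theta> has_real_derivative y) (at t) \<and> 0 \<le> y" by blast
      qed (use u in auto)
      then show ?thesis by (simp add: \<theta>_def zero algebra_simps)
    qed
    moreover have "u\<^sup>2 * (a + b) = u * (1 - u) * K u - (1 - 2 * u) * D u"
      unfolding Du Ku by (simp add: algebra_simps power2_eq_square)
    ultimately have "u\<^sup>2 * (a + b) \<le> 0" by simp
    then show ?thesis using u by (simp add: mult_le_0_iff)
  qed
  define \<psi> where "\<psi> h = D h - a * h - b * h\<^sup>2" for h
  define \<kappa> where "\<kappa> h = K h - (a + 2 * b * h)" for h
  have \<psi>der: "(\<psi> has_real_derivative \<kappa> x) (at x)" if "0 < x" "x < 1" for x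
    unfolding \<psi>_def \<kappa>_def using der[OF that] by (auto intro!: derivative_eq_intros)
  have \<psi>cont: "continuous_on S \<psi>" if "S \<subseteq> {0..1}" for S
    unfolding \<psi>_def using that by (intro continuous_intros continuous_on_subset[OF cont])
  have \<kappa>conv: "convex_on {0<..1/2} \<kappa>"
  proof -
    have "convex_on {0<..1/2} (\<lambda>h. - (a + 2 * b * h))"
      by (rule convex_onI) (auto simp: algebra_simps)
    from convex_on_add[OF conv this] show ?thesis
      by (simp add: \<kappa>_def[abs_def] diff_conv_add_uminus del: minus_add_distrib add_uminus_conv_diff)
  qed
  have \<psi>0: "\<psi> 0 = 0" "\<psi> u = 0" "\<kappa> u = 0" using zero Du Ku by (auto simp: \<psi>_def \<kappa>_def)
  have "\<exists>z>0. z < u \<and> (\<psi> has_real_derivative 0) (at z)"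
  proof (rule Rolle)
    show "\<psi> differentiable (at x)" if "0 < x" "x < u" for x
      using \<psi>der[of x] that u unfolding real_differentiable_def by auto
  qed (use u \<psi>0 \<psi>cont[of "{0..u}"] in auto)
  then obtain v where v: "0 < v" "v < u" "(\<psi> has_real_derivative 0) (at v)" by auto
  have "\<kappa> v = 0" using DERIV_unique[OF v(3) \<psi>der] v u by simp
  note sgn = convex_on_sign[OF \<kappa>conv this \<psi>0(3) v(1,2) u(2)]
  have inc: "\<psi> x \<le> \<psi> y" if "0 \<le> x" "x \<le> y" "y \<le> 1/2" "\<And>t. x < t \<Longrightarrow> t < y \<Longrightarrow> 0 \<le> \<kappa> t" for x y
  proof (rule DERIV_nonneg_imp_increasing_open[of x y \<psi>])
    show "\<exists>d. (\<psi> has_real_derivative d) (at t) \<and> 0 \<le> d" if "x < t" "t < y" for t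
      using \<psi>der[of t] that \<open>0 \<le> x\<close> \<open>y \<le> 1/2\<close> \<open>\<And>t. x < t \<Longrightarrow> t < y \<Longrightarrow> 0 \<le> \<kappa> t\<close>
      by (intro exI[of _ "\<kappa> t"]) auto
  qed (use that in \<open>auto intro!: \<psi>cont\<close>)
  have dec: "\<psi> y \<le> \<psi> x" if "0 \<le> x" "x \<le> y" "y \<le> 1/2" "\<And>t. x < t \<Longrightarrow> t < y \<Longrightarrow> \<kappa> t \<le> 0" for x y
  proof (rule DERIV_nonpos_imp_decreasing_open[of x y \<psi>])
    show "\<exists>d. (\<psi> has_real_derivative d) (at t) \<and> d \<le> 0" if "x < t" "t < y" for t
      using \<psi>der[of t] that \<open>0 \<le> x\<close> \<open>y \<le> 1/2\<close> \<open>\<And>t. x < t \<Longrightarrow> t < y \<Longrightarrow> \<kappa> t \<le> 0\<close>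
      by (intro exI[of _ "\<kappa> t"]) auto
  qed (use that in \<open>auto intro!: \<psi>cont\<close>)
  have \<psi>low: "0 \<le> \<psi> h" if "0 \<le> h" "h \<le> 1/2" for h
  proof -
    consider "h \<le> v" | "v \<le> h" "h \<le> u" | "u \<le> h" by linarith
    then show ?thesis
    proof cases
      case 1
      then show ?thesis using inc[of 0 h] sgn(1) that u v \<psi>0 by simp
    next
      case 2
      then show ?thesis using dec[of h u] sgn(2) that u v \<psi>0 by simp
    next
      case 3
      then show ?thesis using inc[of u h] sgn(3) that u v \<psi>0 by simp
    qed
  qed
  have "0 \<le> \<psi> h" if "0 \<le> h" "h \<le> 1" for h
  proof (cases "h \<le> 1/2")
    case False
    \<comment> \<open>\<open>D\<close> is symmetric, so only the quadratic changes under reflection,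
      and \<open>a + b \<le> 0\<close> gives the change the right sign.\<close>
    have "\<psi> h = \<psi> (1 - h) + (1 - 2 * h) * (a + b)"
      unfolding \<psi>_def sym[OF that] by (simp add: algebra_simps power2_eq_square)
    moreover have "0 \<le> (1 - 2 * h) * (a + b)" using False ab by (simp add: mult_nonpos_nonpos)
    ultimately show ?thesis using \<psi>low[of "1 - h"] False that by simp
  qed (use \<psi>low that in auto)
  then have "\<forall>h\<in>{0..1}. a * h + b * h\<^sup>2 \<le> D h" by (force simp: \<psi>_def)
  with Du show "\<exists>a b. D u = a * u + b * u\<^sup>2 \<and> (\<forall>h\<in>{0..1}. a * h + b * h\<^sup>2 \<le> D h)" by blast
qed (use zero sym in auto)

subsection \<open>Extremal configurations of two cells\<close>

text \<open>\<open>C\<close> abstracts the lower bound on the quadratic moment; \<open>C_ge\<close>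
  bounds it by its value for \<omega>(\<beta>) = 1/4.\<close>

locale two_cell = loss +
  fixes \<rho> \<beta> C :: real
  assumes rho: "0 < \<rho>" "\<rho> < 1" and beta: "0 \<le> \<beta>" "\<beta> \<le> 1/2"
    and C_ge: "(1 - \<rho>) * (1 + \<rho> - \<rho>\<^sup>2) / 2 \<le> C"
begin

text \<open>The part of the coefficient \<beta> lost to noise,
  \<open>\<beta> - \<rho> * \<beta>\<close>.\<close>

definition drift :: real where "drift = (1 - \<rho>) * \<beta>"

text \<open>The first cell has mass \<open>1/2 + \<beta>\<close>, of which \<open>\<alpha>\<close> sits at \<open>u\<close> and the rest at 0; the second
  has mass \<open>1/2 - \<beta>\<close>, of which \<open>r\<close> sits at \<open>v\<close> and the rest at 0. In the notation of \<open>Zcheck\<close>: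
  \<open>u = 1/2 + \<rho> z1\<close>, \<open>v = 1/2 - \<rho> z2\<close>, \<open>\<alpha> = 2 p\<close>, \<open>r = 2 q\<close>.\<close>

definition feasible :: "real \<Rightarrow> bool" where
  "feasible L \<longleftrightarrow> (\<exists>u v \<alpha> r. 0 < u \<and> u \<le> 1/2 \<and> 0 < v \<and> v < 1 \<and> u + v \<le> 1
     \<and> 0 \<le> \<alpha> \<and> \<alpha> \<le> 1/2 + \<beta> \<and> 0 \<le> r \<and> r \<le> 1/2 - \<beta> \<and> \<alpha> * u - r * v = drift
     \<and> C \<le> \<alpha> * u * (2 - 2 * u - \<rho>\<^sup>2) + r * v * (2 - 2 * v - \<rho>\<^sup>2)
     \<and> \<alpha> * D u + r * D v \<le> L)"

lemma feasibleI:
  assumes "0 < u" "u \<le> 1/2" "0 < v" "v < 1" "u + v \<le> 1"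
    "0 \<le> \<alpha>" "\<alpha> \<le> 1/2 + \<beta>" "0 \<le> r" "r \<le> 1/2 - \<beta>" "\<alpha> * u - r * v = drift"
    "C \<le> \<alpha> * u * (2 - 2 * u - \<rho>\<^sup>2) + r * v * (2 - 2 * v - \<rho>\<^sup>2)"
    "\<alpha> * D u + r * D v \<le> L"
  shows "feasible L"
  unfolding feasible_def using assms by blast

lemma rho_sq: "0 < \<rho>\<^sup>2" "\<rho>\<^sup>2 < 1"
  using rho by (auto simp: power_less_one_iff)

text \<open>In the third bound, \<open>drift * (1 - \<rho>\<^sup>2)\<close> is the quadratic value
  of an atom at 1/2 whose integral is \<open>drift\<close>.\<close>

lemma drift_bounds: "0 \<le> drift" "drift \<le> \<beta>" "drift * (1 - \<rho>\<^sup>2) \<le> C" "0 < C"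
proof -
  show "0 \<le> drift" "drift \<le> \<beta>"
    unfolding drift_def using rho beta by (auto simp: mult_left_le_one_le)
  have "drift * (1 - \<rho>\<^sup>2) \<le> (1 - \<rho>) * (1/2) * (1 - \<rho>\<^sup>2)"
    unfolding drift_def using rho beta rho_sq by (intro mult_right_mono mult_left_mono) auto
  also have "\<dots> \<le> (1 - \<rho>) * (1 + \<rho> - \<rho>\<^sup>2) / 2"
    using rho by (simp add: mult_left_mono)
  finally show "drift * (1 - \<rho>\<^sup>2) \<le> C" using C_ge by simp
  have "0 < (1 - \<rho>) * (1 + \<rho> - \<rho>\<^sup>2) / 2" using rho rho_sq by simp
  then show "0 < C" using C_ge by simp
qed

text \<open>Slack in the quadratic constraint is used up by thinning both atoms at fixed positions,
  which is affine in the thinning parameter; if slack remains once the second cell is empty,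
  the atom of the first cell is moved towards 1/2.\<close>

lemma feasible_tight:
  assumes "feasible L"
  obtains u v \<alpha> r where "0 < u" "u \<le> 1/2" "0 < v" "v < 1" "u + v \<le> 1"
    "0 \<le> \<alpha>" "\<alpha> \<le> 1/2 + \<beta>" "0 \<le> r" "r \<le> 1/2 - \<beta>" "\<alpha> * u - r * v = drift"
    "C = \<alpha> * u * (2 - 2 * u - \<rho>\<^sup>2) + r * v * (2 - 2 * v - \<rho>\<^sup>2)"
    "\<alpha> * D u + r * D v \<le> L"
proof -
  obtain u v \<alpha> r where u: "0 < u" "u \<le> 1/2" and v: "0 < v" "v < 1" and uv: "u + v \<le> 1"
    and al: "0 \<le> \<alpha>" "\<alpha> \<le> 1/2 + \<beta>" and r: "0 \<le> r" "r \<le> 1/2 - \<beta>" and d: "\<alpha> * u - r * v = drift"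
    and q: "C \<le> \<alpha> * u * (2 - 2 * u - \<rho>\<^sup>2) + r * v * (2 - 2 * v - \<rho>\<^sup>2)"
    and L: "\<alpha> * D u + r * D v \<le> L"
    using assms unfolding feasible_def by blast
  have Dn: "0 \<le> D u" "0 \<le> D v" using nonneg u v by auto
  have rv: "0 \<le> r * v" using r v by simp
  \<comment> \<open>\<open>F0 + t * X\<close> is the quadratic value once the second atom is thinned
    to \<open>t * r\<close> and the first is adjusted to preserve the balance.\<close>
  define F0 X where "F0 = drift * (2 - 2 * u - \<rho>\<^sup>2)"
    and "X = r * v * (2 - 2 * u - \<rho>\<^sup>2) + r * v * (2 - 2 * v - \<rho>\<^sup>2)"
  have au: "\<alpha> * u = drift + r * v" using d by simp
  have FX: "C \<le> F0 + X" using q unfolding F0_def X_def au by (simp add: algebra_simps)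
  show thesis
  proof (cases "F0 \<le> C")
    case True
    \<comment> \<open>If \<open>X = 0\<close>, then \<open>F0 = C\<close> already, and 0
      serves.\<close>
    define t where "t = (if X = 0 then 0 else (C - F0) / X)"
    have t: "0 \<le> t" "t \<le> 1" "F0 + t * X = C"
      using True FX by (auto simp: t_def divide_simps)
    define a' where "a' = (t * (r * v) + drift) / u"
    have au': "a' * u = t * (r * v) + drift" using u by (simp add: a'_def)
    have "t * (r * v) \<le> r * v" using t rv by (simp add: mult_left_le_one_le)
    then have "a' * u \<le> \<alpha> * u" unfolding au au' by simp
    then have a'le: "a' \<le> \<alpha>" using u by simp
    have a'0: "0 \<le> a'" using u t rv drift_bounds by (simp add: a'_def)
    have tr: "0 \<le> t * r" "t * r \<le> r" using t r by (auto simp: mult_left_le_one_le)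
    have "a' * D u + t * r * D v \<le> \<alpha> * D u + r * D v"
      using a'le tr Dn by (intro add_mono mult_right_mono) auto
    moreover have "C = a' * u * (2 - 2 * u - \<rho>\<^sup>2) + t * r * v * (2 - 2 * v - \<rho>\<^sup>2)"
      unfolding au' t(3)[symmetric] F0_def X_def by (simp add: algebra_simps)
    ultimately show thesis
      using that[of u v a' "t * r"] u v uv a'le a'0 tr al r L au' by (simp add: algebra_simps)
  next
    case False
    have c0: "0 < drift"
      using False drift_bounds unfolding F0_def by (cases "drift = 0") auto
    \<comment> \<open>The position at which a single atom of integral \<open>drift\<close> meets the
      constraint with equality.\<close>
    define u' where "u' = (2 - \<rho>\<^sup>2 - C / drift) / 2"
    have "drift * (2 - 2 * u - \<rho>\<^sup>2) > C" using False unfolding F0_def by simp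
    then have "C / drift < 2 - 2 * u - \<rho>\<^sup>2" using c0 by (simp add: field_simps)
    then have uu': "u < u'" by (simp add: u'_def)
    have "1 - \<rho>\<^sup>2 \<le> C / drift" using drift_bounds(3) c0 by (simp add: field_simps)
    then have u'2: "u' \<le> 1/2" by (simp add: u'_def)
    have "drift * (2 - 2 * u' - \<rho>\<^sup>2) = C" using c0 by (simp add: u'_def field_simps)
    moreover have "drift / u' \<le> \<alpha>"
    proof -
      have "drift / u' \<le> drift / u" using uu' u c0 by (simp add: frac_le)
      also have "\<dots> \<le> \<alpha>" using au rv u by (simp add: field_simps)
      finally show ?thesis .
    qed
    moreover have "drift / u' * D u' \<le> L"
    proof -
      \<comment> \<open>At fixed integral, the cost of an atom is proportional to
        \<open>D x / x\<close>, which decreases towards 1/2.\<close>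
      have "drift * (D u' / u') \<le> drift * (D u / u)"
        using slope_antimono[of u u'] u uu' u'2 c0 by (intro mult_left_mono) auto
      also have "\<dots> = drift / u * D u" by simp
      also have "\<dots> \<le> \<alpha> * D u"
        using au rv u Dn by (intro mult_right_mono) (auto simp: field_simps)
      also have "\<dots> \<le> L" using L mult_nonneg_nonneg[OF r(1) Dn(2)] by linarith
      finally show ?thesis by simp
    qed
    \<comment> \<open>The second atom is empty; its position 1/2 is a placeholder.\<close>
    ultimately show thesis
      using that[of u' "1/2" "drift / u'" 0] u uu' u'2 c0 al beta by simp
  qed
qed

text \<open>The second cell carries the mass \<open>r\<close> at \<open>1 - w\<close> and the rest of its mass at 1. A full
  second cell is reached by pooling the atoms \<open>u\<close> and \<open>w\<close>, or by moving them towards each other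
  until \<open>w\<close> fills its cell.\<close>

lemma feasible_reflected:
  assumes u: "0 < u" "u \<le> 1/2" and w: "0 < w" "w \<le> 1/2"
    and al: "0 \<le> \<alpha>" "\<alpha> \<le> 1/2 + \<beta>" and r: "0 \<le> r" "r \<le> 1/2 - \<beta>"
    and bal: "\<alpha> * u + r * w = 1/2 - \<beta> + drift"
    and q: "C \<le> 2 * (\<alpha> * u * (1 - u)) + 2 * (r * w * (1 - w)) - \<rho>\<^sup>2 * (\<alpha> * u - r * w + (1/2 - \<beta>))"
    and L: "\<alpha> * D u + r * D w \<le> L"
  shows "feasible L"
proof -
  define P where "P = 1/2 - \<beta>"
  define M where "M = \<alpha> * u + r * w"
  have P0: "0 \<le> P" using beta by (simp add: P_def)
  have MP: "M = P + drift" using bal by (simp add: M_def P_def)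
  have M0: "0 < M"
  proof (cases "\<beta> = 1/2")
    case True
    have "0 < drift" unfolding drift_def using rho True by simp
    then show ?thesis using MP P0 by linarith
  next
    case False then show ?thesis using drift_bounds beta unfolding MP P_def by simp
  qed
  \<comment> \<open>The mean position weighted by the integrals of the atoms: pooling at
    \<open>z\<close> keeps both the total integral \<open>M\<close> and the total second
    moment.\<close>
  define z where "z = (\<alpha> * u * u + r * w * w) / M"
  have au: "0 \<le> \<alpha> * u" and rw: "0 \<le> r * w" using al u r w by auto
  have zM: "M * z = \<alpha> * u * u + r * w * w" using M0 by (simp add: z_def)
  have zpos: "0 < z"
  proof -
    have "0 < \<alpha> * u \<or> 0 < r * w" using M0 au rw unfolding M_def by linarith
    then have "0 < \<alpha> * u * u + r * w * w"
      using mult_nonneg_nonneg[of "\<alpha> * u" u] mult_nonneg_nonneg[of "r * w" w]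
        mult_pos_pos[of "\<alpha> * u" u] mult_pos_pos[of "r * w" w] au rw u w by linarith
    then show ?thesis using M0 by (simp add: z_def)
  qed
  have zle: "z \<le> b" if "u \<le> b" "w \<le> b" for b
  proof -
    have "M * z \<le> M * b"
      unfolding zM unfolding M_def distrib_right using that au rw
      by (intro add_mono mult_left_mono) auto
    then show ?thesis using M0 by simp
  qed
  have z2: "z \<le> 1/2" using zle[of "1/2"] u w by simp
  show ?thesis
  proof (cases "r * w \<le> P * z")
    case True
    \<comment> \<open>Pooling: mass \<open>M / z\<close> goes to \<open>z\<close>, of which
      \<open>P\<close> fills the second cell as an atom at \<open>1 - z\<close>. The quadratic
      touching at \<open>z\<close> has the same integral before and after.\<close>
    obtain a b where ab: "D z = a * z + b * z\<^sup>2" "\<forall>h\<in>{0..1}. a * h + b * h\<^sup>2 \<le> D h"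
      using minorant[of z] zpos z2 by auto
    have "M / z * D z = a * M + b * (M * z)"
      using zpos by (simp add: ab(1) field_simps power2_eq_square)
    also have "\<dots> = \<alpha> * (a * u + b * u\<^sup>2) + r * (a * w + b * w\<^sup>2)"
      unfolding zM unfolding M_def by (simp add: algebra_simps power2_eq_square)
    also have "\<dots> \<le> \<alpha> * D u + r * D w"
      using ab(2) u w al r by (intro add_mono mult_left_mono) auto
    finally have loss: "M / z * D z \<le> L" using L by simp
    have "0 \<le> \<alpha> * (u - z)\<^sup>2 + r * (w - z)\<^sup>2" using al r by simp
    also have "\<dots> = M * z - 2 * z * M + (\<alpha> + r) * z\<^sup>2"
      unfolding zM unfolding M_def by (simp add: algebra_simps power2_eq_square)
    finally have "M * z \<le> (\<alpha> + r) * z * z" by (simp add: algebra_simps power2_eq_square)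
    then have "M \<le> (\<alpha> + r) * z" using zpos by simp
    then have mass: "M / z \<le> \<alpha> + r" using zpos by (simp add: field_simps)
    have "P * z \<le> P" using P0 z2 zpos by (simp add: mult_left_le)
    then have "P * z \<le> M" using MP drift_bounds by linarith
    then have low: "P \<le> M / z" using zpos by (simp add: field_simps)
    have m: "(M / z - P) * z = M - P * z" using zpos by (simp add: field_simps)
    show ?thesis
    proof (rule feasibleI[of z "1 - z" "M / z - P" P])
      show "M / z - P \<le> 1/2 + \<beta>" using mass al r by (simp add: P_def)
      show "(M / z - P) * z - P * (1 - z) = drift" unfolding m using MP by (simp add: algebra_simps)
      have "C \<le> 2 * M - 2 * (M * z) - \<rho>\<^sup>2 * (M - 2 * (r * w) + P)"
        using q unfolding zM unfolding M_def P_def by (simp add: algebra_simps)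
      \<comment> \<open>The case assumption says that pooling does not raise the integral of
        \<open>h\<close>.\<close>
      also have "\<dots> \<le> 2 * M - 2 * (M * z) - \<rho>\<^sup>2 * (M - 2 * (P * z) + P)"
        using True rho_sq by (intro diff_left_mono mult_left_mono) auto
      also have "\<dots> = (M - P * z) * (2 - 2 * z - \<rho>\<^sup>2) + P * (1 - z) * (2 - 2 * (1 - z) - \<rho>\<^sup>2)"
        by (simp add: algebra_simps)
      finally show "C \<le> (M / z - P) * z * (2 - 2 * z - \<rho>\<^sup>2) + P * (1 - z) * (2 - 2 * (1 - z) - \<rho>\<^sup>2)"
        unfolding m .
      show "(M / z - P) * D z + P * D (1 - z) \<le> L"
        using loss sym[of z] zpos z2 by (simp add: algebra_simps)
    qed (use zpos z2 low P0 in \<open>auto simp: P_def\<close>)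
  next
    case False
    have Ppos: "0 < P"
    proof (rule ccontr)
      assume "\<not> 0 < P"
      then have "P = 0" "r = 0" using P0 r by (auto simp: P_def)
      then show False using False by simp
    qed
    \<comment> \<open>The position at which the full mass \<open>P\<close> has the old integral
      \<open>r * w\<close>.\<close>
    define w' where "w' = r * w / P"
    have w'P: "P * w' = r * w" using Ppos by (simp add: w'_def)
    have "P * z < P * w'" using False w'P by simp
    then have zw': "z < w'" using Ppos by simp
    have "r * w \<le> P * w" using r w by (intro mult_right_mono) (auto simp: P_def)
    then have w'w: "w' \<le> w" using Ppos w'P by (metis mult_le_cancel_left_pos)
    have aupos: "0 < \<alpha> * u"
    proof (rule ccontr)
      assume "\<not> 0 < \<alpha> * u"
      then have "r * w = P + drift" using au MP unfolding M_def by linarith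
      moreover have "r * w \<le> P * (1/2)" using r w by (intro mult_mono) (auto simp: P_def)
      ultimately show False using Ppos drift_bounds by simp
    qed
    \<comment> \<open>The compensating shift that restores the total second moment
      \<open>M * z\<close>.\<close>
    define u' where "u' = u + r * w * (w - w') / (\<alpha> * u)"
    have s: "\<alpha> * u * u' + r * w * w' = M * z"
    proof -
      have "\<alpha> * u * u' = \<alpha> * u * u + r * w * (w - w')"
        unfolding u'_def distrib_left using aupos by auto
      then show ?thesis unfolding zM by (simp add: algebra_simps)
    qed
    have uu': "u \<le> u'" using rw w'w aupos by (simp add: u'_def)
    have u'z: "u' < z"
    proof -
      have "0 < r * w" using False P0 zpos by (smt (verit) mult_nonneg_nonneg)
      then have "r * w * z < r * w * w'" using zw' by (rule mult_strict_left_mono[rotated])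
      then have "\<alpha> * u * u' < \<alpha> * u * z" using s unfolding M_def by (simp add: algebra_simps)
      then show ?thesis using aupos mult_less_cancel_left_pos by blast
    qed
    have uz: "u < z" using uu' u'z by simp
    \<comment> \<open>With the integrals as weights, the loss is a weighted sum of values of the
      convex \<open>G\<close>; moving both positions inwards with fixed weighted mean cannot raise
      it.\<close>
    define G where "G x = D x / x" for x
    define sl where "sl = (G w - G u) / (w - u)"
    have chord: "G x \<le> sl * (x - u) + G u" if "u \<le> x" "x \<le> w" for x
    proof -
      have "convex_on {u..w} G"
        using u w unfolding G_def[abs_def] by (intro convex_on_subset[OF slope_convex]) auto
      from convex_onD_Icc'[OF this, of x] that show ?thesis unfolding sl_def by simp
    qed
    define a' where "a' = \<alpha> * u / u'"
    have a'u: "a' * u' = \<alpha> * u" using u uu' by (simp add: a'_def)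
    have loss: "a' * D u' + P * D w' \<le> L"
    proof -
      have "a' * D u' + P * D w' = \<alpha> * u * G u' + r * w * G w'"
        unfolding a'u[symmetric] w'P[symmetric] G_def using u uu' zw' zpos by simp
      also have "\<dots> \<le> \<alpha> * u * (sl * (u' - u) + G u) + r * w * (sl * (w' - u) + G u)"
        using au rw chord[of u'] chord[of w'] uu' u'z zw' w'w uz
        by (intro add_mono mult_left_mono) auto
      also have "\<dots> = sl * (\<alpha> * u * u' + r * w * w') - sl * u * M + G u * M"
        unfolding M_def by (simp add: algebra_simps)
      also have "\<dots> = r * w * (sl * (w - u)) + G u * M"
        unfolding s zM unfolding M_def by (simp add: algebra_simps)
      also have "sl * (w - u) = G w - G u" using uz zw' w'w by (simp add: sl_def)
      also have "r * w * (G w - G u) + G u * M = \<alpha> * D u + r * D w"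
        unfolding M_def G_def using u w by (simp add: field_simps)
      finally show ?thesis using L by simp
    qed
    show ?thesis
    proof (rule feasibleI[of u' "1 - w'" a' P])
      have "a' \<le> \<alpha>" unfolding a'_def using u uu' al by (simp add: divide_le_eq mult_left_mono)
      then show "a' \<le> 1/2 + \<beta>" using al by simp
      show "a' * u' - P * (1 - w') = drift"
        unfolding a'u using w'P MP unfolding M_def by (simp add: algebra_simps)
      have "C \<le> 2 * M - 2 * (M * z) - \<rho>\<^sup>2 * (\<alpha> * u - r * w + P)"
        using q unfolding zM unfolding M_def P_def by (simp add: algebra_simps)
      also have "\<dots> = \<alpha> * u * (2 - 2 * u' - \<rho>\<^sup>2) + (P - r * w) * (2 * w' - \<rho>\<^sup>2)
          + 2 * (r * w - P * w')"
        unfolding s[symmetric] unfolding M_def by (simp add: algebra_simps)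
      also have "\<dots> = a' * u' * (2 - 2 * u' - \<rho>\<^sup>2) + P * (1 - w') * (2 - 2 * (1 - w') - \<rho>\<^sup>2)"
        unfolding a'u w'P[symmetric] by (simp add: algebra_simps)
      finally show "C \<le> a' * u' * (2 - 2 * u' - \<rho>\<^sup>2) + P * (1 - w') * (2 - 2 * (1 - w') - \<rho>\<^sup>2)" .
      show "a' * D u' + P * D (1 - w') \<le> L"
        using loss sym[of w'] zw' zpos w'w w by simp
      show "0 \<le> a'" using au u uu' by (simp add: a'_def)
    qed (use u uu' u'z zw' w'w w z2 Ppos in \<open>auto simp: P_def\<close>)
  qed
qed


text \<open>Reduces arbitrary values on two cells to the two-atom form. The cases record which cells
  collapse to an atom, directly or after the reflection of \<open>h\<close> to
  \<open>1 - h\<close>.\<close>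

lemma feasible_of_moments:
  fixes I J :: "'i set" and k h :: "'i \<Rightarrow> real"
  assumes fin: "finite I" "finite J"
    and k: "\<And>x. x \<in> I \<union> J \<Longrightarrow> 0 \<le> k x" and h: "\<And>x. x \<in> I \<union> J \<Longrightarrow> 0 \<le> h x \<and> h x \<le> 1"
    and PI: "sum k I = 1/2 + \<beta>" and PJ: "sum k J = 1/2 - \<beta>"
    and bal: "(\<Sum>x\<in>I. k x * h x) - (\<Sum>x\<in>J. k x * h x) = drift"
    and q: "C \<le> 2 * ((\<Sum>x\<in>I. k x * (h x * (1 - h x))) + (\<Sum>x\<in>J. k x * (h x * (1 - h x))))
      - \<rho>\<^sup>2 * ((\<Sum>x\<in>I. k x * h x) + (\<Sum>x\<in>J. k x * h x))"
  shows "feasible ((\<Sum>x\<in>I. k x * D (h x)) + (\<Sum>x\<in>J. k x * D (h x)))"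
proof -
  define m1 m2 e1 e2 L1 L2 where m1: "m1 = (\<Sum>x\<in>I. k x * h x)" and m2: "m2 = (\<Sum>x\<in>J. k x * h x)"
    and e1: "e1 = (\<Sum>x\<in>I. k x * (h x * (1 - h x)))" and e2: "e2 = (\<Sum>x\<in>J. k x * (h x * (1 - h x)))"
    and L1: "L1 = (\<Sum>x\<in>I. k x * D (h x))" and L2: "L2 = (\<Sum>x\<in>J. k x * D (h x))"
  note folds = m1[symmetric] m2[symmetric] e1[symmetric] e2[symmetric] L1[symmetric] L2[symmetric]
  define D2 where "D2 = D (1/2)"
  define P where "P = 1/2 - \<beta>"
  have D2: "0 \<le> D2" using nonneg[of "1/2"] by (simp add: D2_def)
  have b: "m1 = m2 + drift" and q: "C \<le> 2 * (e1 + e2) - \<rho>\<^sup>2 * (m1 + m2)"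
    using bal q unfolding folds by auto
  \<comment> \<open>Consequently, mass \<open>4 * e\<close> at 1/2 fits into a cell, reproduces its
    \<open>e\<close> and costs at most the loss of the cell.\<close>
  have cell: "0 \<le> (\<Sum>x\<in>K. k x * (h x * (1 - h x)))"
    "0 \<le> (\<Sum>x\<in>K. k x * h x)"
    "(\<Sum>x\<in>K. k x * (h x * (1 - h x))) \<le> sum k K / 4"
    "4 * D2 * (\<Sum>x\<in>K. k x * (h x * (1 - h x))) \<le> (\<Sum>x\<in>K. k x * D (h x))"
    if "K \<subseteq> I \<union> J" for K
  proof -
    note kh = k[OF subsetD[OF that]] h[OF subsetD[OF that]]
    show "0 \<le> (\<Sum>x\<in>K. k x * (h x * (1 - h x)))" "0 \<le> (\<Sum>x\<in>K. k x * h x)"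
      using kh by (auto intro!: sum_nonneg)
    have quarter: "y * (1 - y) \<le> 1/4" for y :: real
      using zero_le_power2[of "y - 1/2"] by (simp add: power2_eq_square algebra_simps)
    show "(\<Sum>x\<in>K. k x * (h x * (1 - h x))) \<le> sum k K / 4"
      unfolding sum_divide_distrib using kh mult_left_mono[OF quarter] by (intro sum_mono) force
    show "4 * D2 * (\<Sum>x\<in>K. k x * (h x * (1 - h x))) \<le> (\<Sum>x\<in>K. k x * D (h x))"
      unfolding sum_distrib_left D2_def
    proof (rule sum_mono)
      fix x assume "x \<in> K"
      then show "4 * D (1/2) * (k x * (h x * (1 - h x))) \<le> k x * D (h x)"
        using mult_left_mono[OF half_minorant[of "h x"], of "k x"] kh by (simp add: algebra_simps)
    qed
  qed
  have e: "0 \<le> e1" "0 \<le> e2" "4 * e1 \<le> 1/2 + \<beta>" "4 * e2 \<le> P" and m: "0 \<le> m1" "0 \<le> m2"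
    and half: "4 * D2 * e1 \<le> L1" "4 * D2 * e2 \<le> L2"
    using cell[of I] cell[of J] unfolding folds PI PJ P_def by auto
  have atom1: "\<exists>\<alpha> u. 0 < u \<and> u \<le> 1/2 \<and> 0 \<le> \<alpha> \<and> \<alpha> \<le> 1/2 + \<beta> \<and> \<alpha> * u = m1 \<and> \<alpha> * u * (1 - u) = e1
      \<and> \<alpha> * D u \<le> L1" if "m1 \<le> 2 * e1"
    using atomic_moments[of I k h] that fin k h unfolding folds PI by auto
  have atom2: "\<exists>\<alpha> u. 0 < u \<and> u \<le> 1/2 \<and> 0 \<le> \<alpha> \<and> \<alpha> \<le> P \<and> \<alpha> * u = m2 \<and> \<alpha> * u * (1 - u) = e2
      \<and> \<alpha> * D u \<le> L2" if "m2 \<le> 2 * e2"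
    using atomic_moments[of J k h] that fin k h unfolding folds PJ P_def by auto
  have atom3: "\<exists>\<alpha> u. 0 < u \<and> u \<le> 1/2 \<and> 0 \<le> \<alpha> \<and> \<alpha> \<le> P \<and> \<alpha> * u = P - m2 \<and> \<alpha> * u * (1 - u) = e2
      \<and> \<alpha> * D u \<le> L2" if "P - m2 \<le> 2 * e2"
  proof -
    have n: "(\<Sum>x\<in>J. k x * (1 - h x)) = P - m2"
      unfolding P_def PJ[symmetric] m2 by (simp add: sum_subtractf right_diff_distrib)
    have "(\<Sum>x\<in>J. k x * D (1 - h x)) = L2"
      unfolding L2 using h sym by (intro sum.cong) auto
    moreover have "(\<Sum>x\<in>J. k x * ((1 - h x) * (1 - (1 - h x)))) = e2"
      unfolding e2 by (intro sum.cong) (auto simp: algebra_simps)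
    ultimately show ?thesis
      using atomic_moments[of J k "\<lambda>x. 1 - h x"] that fin k h unfolding n PJ P_def by auto
  qed
  \<comment> \<open>A cell with \<open>m \<le> 2 e\<close> collapses to atoms at 0 and some \<open>u \<le> 1/2\<close>. Otherwise it is treated
    as atoms at 0, 1/2 and 1, and the atom at 1 is removed by moving mass of both cells so that
    the difference of the \<open>m\<close> and the sum of the \<open>e\<close> are kept while the \<open>m\<close> drop.\<close>
  have "feasible (L1 + L2)"
  proof (cases "m1 \<le> 2 * e1")
    case True
    then obtain \<alpha> u where A: "0 < u" "u \<le> 1/2" "0 \<le> \<alpha>" "\<alpha> \<le> 1/2 + \<beta>" "\<alpha> * u = m1"
      "\<alpha> * u * (1 - u) = e1" "\<alpha> * D u \<le> L1" using atom1 by blast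
    show ?thesis
    proof (cases "m2 \<le> 2 * e2")
      case True
      then obtain r v where B: "0 < v" "v \<le> 1/2" "0 \<le> r" "r \<le> P" "r * v = m2"
        "r * v * (1 - v) = e2" "r * D v \<le> L2" using atom2 by blast
      have "C \<le> \<alpha> * u * (2 - 2 * u - \<rho>\<^sup>2) + r * v * (2 - 2 * v - \<rho>\<^sup>2)"
        using q unfolding A(5,6)[symmetric] B(5,6)[symmetric] by (simp add: algebra_simps)
      then show ?thesis
        using A B b by (intro feasibleI[of u v \<alpha> r]) (auto simp: P_def)
    next
      case m2e: False
      show ?thesis
      proof (cases "P - m2 \<le> 2 * e2")
        case True
        then obtain r w where B: "0 < w" "w \<le> 1/2" "0 \<le> r" "r \<le> P" "r * w = P - m2"
          "r * w * (1 - w) = e2" "r * D w \<le> L2" using atom3 by blast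
        have "C \<le> 2 * (\<alpha> * u * (1 - u)) + 2 * (r * w * (1 - w)) - \<rho>\<^sup>2 * (\<alpha> * u - r * w + (1/2 - \<beta>))"
          using q unfolding A(6) B(6) unfolding A(5) B(5) by (simp add: P_def algebra_simps)
        then show ?thesis
          using A B b by (intro feasible_reflected[of u w \<alpha> r]) (auto simp: P_def)
      next
        case False
        \<comment> \<open>The second cell is modelled by mass \<open>4 * e2\<close> at 1/2,
          \<open>g\<close> at 1 and \<open>P - m2 - 2 * e2\<close> at 0. Taking \<open>d\<close>
          from the first atom and adding \<open>4 * u * (1 - u) * d\<close> at 1/2 keeps the total
          \<open>e\<close>; to keep the balance, the mass at 1 drops by
          \<open>u * (3 - 2 * u) * d\<close> and that at 0 by \<open>u * (1 - 2 * u) * d\<close>.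
          The value \<open>d1\<close> empties the atom at 1.\<close>
        define g where "g = m2 - 2 * e2"
        define d1 where "d1 = g / (u * (3 - 2 * u))"
        have g: "0 < g" using m2e by (simp add: g_def)
        have u3: "0 < u * (3 - 2 * u)" using A by simp
        have trade: "4 * u * (1 - u) * D2 \<le> D u" unfolding D2_def using half_minorant[of u] A by simp
        have lossd: "(\<alpha> - d) * D u + (4 * e2 + 4 * u * (1 - u) * d) * D2 \<le> L1 + L2" if "0 \<le> d" for d
        proof -
          have "d * (4 * u * (1 - u) * D2) \<le> d * D u" using trade that by (rule mult_left_mono)
          then show ?thesis using A(7) half(2) by (simp add: algebra_simps)
        qed
        have qd: "C \<le> 2 * (e1 + e2) - \<rho>\<^sup>2 * (m1 + m2 - 2 * (u * d))" if "0 \<le> d" for d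
        proof -
          have "0 \<le> \<rho>\<^sup>2 * (2 * (u * d))" using that A by simp
          then show ?thesis using q by (simp add: algebra_simps)
        qed
        show ?thesis
        \<comment> \<open>Whether the mass at 0 is still nonnegative when the atom at 1 runs
          out.\<close>
        proof (cases "m2 + 2 * e2 + u * (1 - 2 * u) * d1 \<le> P")
          case True
          have d1: "0 \<le> d1" using g u3 by (simp add: d1_def)
          have d1g: "u * (3 - 2 * u) * d1 = m2 - 2 * e2" using A by (auto simp: d1_def g_def)
          define r' where "r' = 4 * e2 + 4 * u * (1 - u) * d1"
          have r'0: "0 \<le> r'" using e d1 A by (simp add: r'_def)
          have r'm: "r' / 2 = m2 - u * d1" using d1g by (simp add: r'_def field_simps)
          have am: "(\<alpha> - d1) * u = drift + r' / 2" using A(5) b r'm by (simp add: field_simps)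
          have "0 \<le> (\<alpha> - d1) * u" using am r'0 drift_bounds by simp
          then have a0: "0 \<le> \<alpha> - d1" using A(1) by (simp add: zero_le_mult_iff)
          have sums: "drift + r' / 2 + r' / 2 = m1 + m2 - 2 * (u * d1)" using r'm b by simp
          show ?thesis
          proof (rule feasibleI[of u "1/2" "\<alpha> - d1" r'])
            show "r' \<le> 1/2 - \<beta>"
              using True d1g by (simp add: r'_def P_def field_simps)
            have "(\<alpha> - d1) * u * (2 - 2 * u - \<rho>\<^sup>2) + r' * (1/2) * (2 - 2 * (1/2) - \<rho>\<^sup>2)
              = 2 * (\<alpha> * u * (1 - u) + e2) - \<rho>\<^sup>2 * ((\<alpha> - d1) * u + r' / 2)"
              by (simp add: r'_def field_simps)
            also have "\<dots> = 2 * (e1 + e2) - \<rho>\<^sup>2 * (m1 + m2 - 2 * (u * d1))"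
              unfolding A(6) am sums ..
            finally show "C \<le> (\<alpha> - d1) * u * (2 - 2 * u - \<rho>\<^sup>2) + r' * (1/2) * (2 - 2 * (1/2) - \<rho>\<^sup>2)"
              using qd[OF d1] by simp
            show "(\<alpha> - d1) * D u + r' * D (1/2) \<le> L1 + L2"
              using lossd[OF d1] by (simp add: r'_def D2_def)
          qed (use A a0 d1 r'0 am in auto)
        next
          case F2: False
          have u12: "0 < u * (1 - 2 * u)"
            using F2 \<open>\<not> P - m2 \<le> 2 * e2\<close> A by (cases "u = 1/2") auto
          \<comment> \<open>The mass at 0 runs out first; atoms at 1/2 and 1 remain, the reflected
            form with \<open>w = 1/2\<close>.\<close>
          define d2 where "d2 = (P - m2 - 2 * e2) / (u * (1 - 2 * u))"
          have d2: "0 \<le> d2" using u12 False by (simp add: d2_def)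
          have d2g: "u * (1 - 2 * u) * d2 = P - m2 - 2 * e2" using A u12 by (auto simp: d2_def)
          have "u * (1 - 2 * u) * d2 < u * (1 - 2 * u) * d1" using F2 d2g by simp
          then have "d2 < d1" using u12 mult_less_cancel_left_pos by blast
          then have "u * (3 - 2 * u) * d2 < u * (3 - 2 * u) * d1" using u3 by (rule mult_strict_left_mono)
          then have d2m: "u * (3 - 2 * u) * d2 < m2 - 2 * e2" using A by (auto simp: d1_def g_def)
          define r' where "r' = 4 * e2 + 4 * u * (1 - u) * d2"
          have r'0: "0 \<le> r'" using e d2 A by (simp add: r'_def)
          have r'm: "P - r' / 2 = m2 - u * d2" using d2g by (simp add: r'_def field_simps)
          have am: "(\<alpha> - d2) * u = drift + (P - r' / 2)" using A(5) b r'm by (simp add: field_simps)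
          have rP: "r' \<le> P" using d2m d2g by (simp add: r'_def field_simps)
          have "0 \<le> (\<alpha> - d2) * u" using am rP r'0 drift_bounds by simp
          then have a0: "0 \<le> \<alpha> - d2" using A(1) by (simp add: zero_le_mult_iff)
          have sums: "drift + (P - r' / 2) + (P - r' / 2) = m1 + m2 - 2 * (u * d2)" using r'm b by simp
          show ?thesis
          proof (rule feasible_reflected[of u "1/2" "\<alpha> - d2" r'])
            have "2 * ((\<alpha> - d2) * u * (1 - u)) + 2 * (r' * (1/2) * (1 - 1/2))
                - \<rho>\<^sup>2 * ((\<alpha> - d2) * u - r' * (1/2) + (1/2 - \<beta>))
              = 2 * (\<alpha> * u * (1 - u) + e2) - \<rho>\<^sup>2 * ((\<alpha> - d2) * u + (P - r' / 2))"
              by (simp add: r'_def P_def field_simps)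
            also have "\<dots> = 2 * (e1 + e2) - \<rho>\<^sup>2 * (m1 + m2 - 2 * (u * d2))"
              unfolding A(6) am sums ..
            finally show "C \<le> 2 * ((\<alpha> - d2) * u * (1 - u)) + 2 * (r' * (1/2) * (1 - 1/2))
                - \<rho>\<^sup>2 * ((\<alpha> - d2) * u - r' * (1/2) + (1/2 - \<beta>))"
              using qd[OF d2] by simp
            show "(\<alpha> - d2) * D u + r' * D (1/2) \<le> L1 + L2"
              using lossd[OF d2] by (simp add: r'_def D2_def)
            show "(\<alpha> - d2) * u + r' * (1/2) = 1/2 - \<beta> + drift" using am by (simp add: P_def)
          qed (use A a0 d2 r'0 rP in \<open>auto simp: P_def\<close>)
        qed
      qed
    qed
  next
    case m1e: False
    define e where "e = e1 + e2"
    have low: "drift \<le> 2 * e"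
    proof -
      have "\<rho>\<^sup>2 * drift \<le> \<rho>\<^sup>2 * (m1 + m2)" using b m rho_sq by (intro mult_left_mono) auto
      then have "C + \<rho>\<^sup>2 * drift \<le> 2 * e" using q by (simp add: e_def)
      then show ?thesis using drift_bounds(3) by (simp add: algebra_simps)
    qed
    show ?thesis
    proof (cases "m2 \<le> 2 * e2")
      case True
      then obtain \<alpha> u where B: "0 < u" "u \<le> 1/2" "0 \<le> \<alpha>" "\<alpha> \<le> P" "\<alpha> * u = m2"
        "\<alpha> * u * (1 - u) = e2" "\<alpha> * D u \<le> L2" using atom2 by blast
      \<comment> \<open>The same exchange with the cells interchanged, stopped when the atom at 1 in
        the first cell is gone.\<close>
      define d where "d = (m1 - 2 * e1) / (u * (3 - 2 * u))"
      have u3: "0 < u * (3 - 2 * u)" using B by simp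
      have d: "0 \<le> d" using m1e u3 by (simp add: d_def)
      have dg: "u * (3 - 2 * u) * d = m1 - 2 * e1" using B by (auto simp: d_def)
      define r' where "r' = 4 * e1 + 4 * u * (1 - u) * d"
      have r'0: "0 \<le> r'" using \<open>0 \<le> e1\<close> d B by (simp add: r'_def)
      have r'm: "r' / 2 = m1 - u * d" using dg by (simp add: r'_def field_simps)
      have am: "r' / 2 - (\<alpha> - d) * u = drift" using B(5) b r'm by (simp add: field_simps)
      \<comment> \<open>The remaining mass is a positive multiple of \<open>2 * e - drift\<close>,
        so \<open>low\<close> keeps it nonnegative.\<close>
      have a0: "0 \<le> \<alpha> - d"
      proof -
        have "u * (3 - 2 * u) * (\<alpha> - d) = \<alpha> * u + 2 * (\<alpha> * u * (1 - u)) - u * (3 - 2 * u) * d"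
          by (simp add: algebra_simps)
        then have "u * (3 - 2 * u) * (\<alpha> - d) = 2 * e - drift"
          unfolding dg B(6) unfolding B(5) using b by (simp add: e_def)
        then show ?thesis using low u3 by (smt (verit) mult_pos_neg)
      qed
      have "(\<alpha> - d) * u \<le> P * (1/2)" using a0 B d by (intro mult_mono) (auto simp: P_def)
      then have rle: "r' \<le> 1/2 + \<beta>" using am drift_bounds by (simp add: P_def)
      show ?thesis
      proof (rule feasibleI[of "1/2" u r' "\<alpha> - d"])
        have "0 \<le> \<rho>\<^sup>2 * (2 * (u * d))" using d B by simp
        then have "C \<le> 2 * (e1 + e2) - \<rho>\<^sup>2 * (m1 + m2 - 2 * (u * d))" using q by (simp add: algebra_simps)
        also have "\<dots> = 2 * (e1 + \<alpha> * u * (1 - u)) - \<rho>\<^sup>2 * (r' / 2 + (\<alpha> - d) * u)"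
          unfolding r'm B(6) using B(5) by (simp add: algebra_simps)
        also have "\<dots> = r' * (1/2) * (2 - 2 * (1/2) - \<rho>\<^sup>2) + (\<alpha> - d) * u * (2 - 2 * u - \<rho>\<^sup>2)"
          by (simp add: r'_def field_simps)
        finally show "C \<le> r' * (1/2) * (2 - 2 * (1/2) - \<rho>\<^sup>2) + (\<alpha> - d) * u * (2 - 2 * u - \<rho>\<^sup>2)" .
        have "d * (4 * u * (1 - u) * D2) \<le> d * D u"
          using half_minorant[of u] B d unfolding D2_def by (intro mult_left_mono) auto
        then show "r' * D (1/2) + (\<alpha> - d) * D u \<le> L1 + L2"
          using B(7) half(1) unfolding r'_def D2_def[symmetric] by (simp add: algebra_simps)
      qed (use B a0 d r'0 rle am in \<open>auto simp: P_def\<close>)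
    next
      case m2e: False
      have q2: "C \<le> 2 * e - \<rho>\<^sup>2 * (m1' + m2')" if "m1' \<le> m1" "m2' \<le> m2" for m1' m2'
      proof -
        have "\<rho>\<^sup>2 * (m1' + m2') \<le> \<rho>\<^sup>2 * (m1 + m2)" using that rho_sq by (intro mult_left_mono) auto
        then show ?thesis using q by (simp add: e_def)
      qed
      show ?thesis
      proof (cases "2 * e \<le> P + drift")
        case True
        show ?thesis
        \<comment> \<open>Everything is placed at 1/2: these masses have total \<open>4 * e\<close>
          and half-difference \<open>drift\<close>.\<close>
        proof (rule feasibleI[of "1/2" "1/2" "2 * e + drift" "2 * e - drift"])
          show "C \<le> (2 * e + drift) * (1/2) * (2 - 2 * (1/2) - \<rho>\<^sup>2)
              + (2 * e - drift) * (1/2) * (2 - 2 * (1/2) - \<rho>\<^sup>2)"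
            using q2[of "2 * e1" "2 * e2"] m1e m2e by (simp add: algebra_simps e_def)
          show "2 * e + drift \<le> 1/2 + \<beta>"
            using \<open>4 * e1 \<le> 1/2 + \<beta>\<close> \<open>4 * e2 \<le> P\<close> drift_bounds by (simp add: e_def P_def)
          show "(2 * e + drift) * D (1/2) + (2 * e - drift) * D (1/2) \<le> L1 + L2"
            using half unfolding D2_def[symmetric] e_def by (simp add: algebra_simps)
        qed (use True low drift_bounds in \<open>auto simp: P_def field_simps\<close>)
      next
        case False
        \<comment> \<open>With mass \<open>4 * e1\<close> at 1/2 in the first cell, the balance
          forces this integral of \<open>1 - h\<close> on the second.\<close>
        define n' where "n' = P + drift - 2 * e1"
        have n': "P - m2 < n'" "n' < 2 * e2" using m1e False b by (auto simp: n'_def e_def)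
        then obtain r w where B: "0 < w" "w \<le> 1/2" "0 \<le> r" "r \<le> P" "r * w = P - m2"
          "r * w * (1 - w) = e2" "r * D w \<le> L2" using atom3 by auto
        have rw0: "0 \<le> r * w" using B(1,3) by simp
        then have n'0: "0 < n'" using n' B(5) by simp
        \<comment> \<open>Mass \<open>n' / w'\<close> at \<open>1 - w'\<close>, with the rest at 1,
          then has the integral \<open>n'\<close> of \<open>1 - h\<close> and the old
          \<open>e2\<close>.\<close>
        define w' where "w' = 1 - e2 / n'"
        have rw_nz: "r * w \<noteq> 0" using n' n'0 B(6) by auto
        then have rwpos: "0 < r * w" using rw0 by linarith
        have e2pos: "0 < e2" using n' n'0 by simp
        have w'n: "n' * (1 - w') = e2" using n'0 by (simp add: w'_def)
        have ww': "w \<le> w'"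
        proof -
          have "e2 / n' \<le> e2 / (r * w)" using n' rwpos e2pos B(5) by (intro divide_left_mono) auto
          also have "\<dots> = 1 - w"
            unfolding B(6)[symmetric] by (rule nonzero_mult_div_cancel_left[OF rw_nz])
          finally show ?thesis by (simp add: w'_def)
        qed
        have w'2: "w' \<le> 1/2" using n' n'0 by (simp add: w'_def field_simps)
        have w'pos: "0 < w'" using ww' B by simp
        \<comment> \<open>\<open>x * (P - x)\<close> does not decrease from \<open>r * w\<close> to
          \<open>n'\<close>, because these two sum to at most \<open>P\<close>.\<close>
        have r'P: "n' / w' \<le> P"
        proof -
          have "P * e2 = P * (r * w) - (r * w) * (P * w)" unfolding B(6)[symmetric] by (simp add: algebra_simps)
          also have "\<dots> \<le> P * (r * w) - (r * w) * (r * w)"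
            using B rw0 by (intro diff_left_mono mult_left_mono mult_right_mono) auto
          also have "\<dots> \<le> P * n' - n' * n'"
          proof -
            have "r * w \<le> n'" "n' + r * w \<le> P" using n' B(5) \<open>4 * e2 \<le> P\<close> by auto
            then have "0 \<le> (n' - r * w) * (P - (n' + r * w))" by simp
            then show ?thesis by (simp add: algebra_simps)
          qed
          finally have "n' * n' \<le> n' * (P * w')" unfolding w'n[symmetric] by (simp add: algebra_simps)
          then have "n' \<le> P * w'" using n'0 by simp
          then show ?thesis using w'pos by (simp add: field_simps)
        qed
        \<comment> \<open>At fixed \<open>e2\<close> the cost is \<open>e2\<close> times the ratio
          of \<open>ratio_antimono\<close>, and \<open>w \<le> w'\<close>.\<close>
        have loss': "n' / w' * D w' \<le> L2"
        proof -
          have "n' / w' * D w' = e2 * (D w' / (w' * (1 - w')))"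
            unfolding w'n[symmetric] using w'2 by simp
          also have "\<dots> \<le> e2 * (D w / (w * (1 - w)))"
            using ratio_antimono[of w w'] B ww' w'2 e2pos by (intro mult_left_mono) auto
          also have "\<dots> = r * D w" unfolding B(6)[symmetric] using B(1,2) by simp
          finally show ?thesis using B(7) by simp
        qed
        show ?thesis
        proof (rule feasible_reflected[of "1/2" w' "4 * e1" "n' / w'"])
          show "C \<le> 2 * (4 * e1 * (1/2) * (1 - 1/2)) + 2 * (n' / w' * w' * (1 - w'))
              - \<rho>\<^sup>2 * (4 * e1 * (1/2) - n' / w' * w' + (1/2 - \<beta>))"
            using q2[of "2 * e1" "P - n'"] m1e n' w'n w'pos by (simp add: e_def P_def algebra_simps)
          show "4 * e1 * D (1/2) + n' / w' * D w' \<le> L1 + L2"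
            using loss' half(1) unfolding D2_def by (simp add: algebra_simps)
          show "4 * e1 * (1/2) + n' / w' * w' = 1/2 - \<beta> + drift"
            using w'pos by (simp add: n'_def P_def)
        qed (use w'pos w'2 n'0 r'P \<open>4 * e1 \<le> 1/2 + \<beta>\<close> \<open>0 \<le> e1\<close> in \<open>auto simp: P_def\<close>)
      qed
    qed
  qed
  then show ?thesis unfolding folds .
qed

end

subsection \<open>The stability bound\<close>

text \<open>Symmetry makes \<Phi>' vanish at 1/2; monotonicity and concavity of \<Phi>' then give
  the sign and the convexity of the derivative of the loss.\<close>

lemma loss_of_Phi:
  fixes \<Phi> :: "real \<Rightarrow> real"
  assumes sym: "\<forall>x\<in>{0..1}. \<Phi> (1 - x) = \<Phi> x"
    and cont: "continuous_on {0..1} \<Phi>"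
    and diff: "\<Phi> differentiable_on {0<..<1}"
    and mono_deriv: "mono_on {0<..<1} (deriv \<Phi>)"
    and conc_deriv: "strictly_concave_on {0<..1/2} (deriv \<Phi>)"
  shows "loss (\<lambda>h. \<Phi> 0 - \<Phi> h)"
proof (rule loss_of_deriv[where K = "\<lambda>x. - deriv \<Phi> x"])
  have der: "(\<Phi> has_real_derivative deriv \<Phi> x) (at x)" if "0 < x" "x < 1" for x
  proof -
    have "\<Phi> differentiable (at x within {0<..<1})"
      using diff that by (simp add: differentiable_on_def)
    then have "\<Phi> differentiable (at x)"
      using that by (simp add: at_within_open[of x "{0<..<1}"])
    then show ?thesis using DERIV_deriv_iff_real_differentiable by blast
  qed
  show "((\<lambda>h. \<Phi> 0 - \<Phi> h) has_real_derivative - deriv \<Phi> x) (at x)" if "0 < x" "x < 1" for x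
    using der[OF that] by (auto intro!: derivative_eq_intros)
  have "((\<lambda>x. \<Phi> (1 - x)) has_real_derivative deriv \<Phi> (1/2) * (-1)) (at (1/2))"
    by (rule DERIV_chain2[where f = \<Phi>]) (use der[of "1/2"] in \<open>auto intro!: derivative_eq_intros\<close>)
  moreover have "eventually (\<lambda>x. \<Phi> (1 - x) = \<Phi> x) (nhds (1/2))"
    by (rule eventually_mono[OF eventually_nhds_in_open[of "{0<..<1}"]]) (use sym in auto)
  ultimately have "(\<Phi> has_real_derivative deriv \<Phi> (1/2) * (-1)) (at (1/2))"
    using DERIV_cong_ev[OF refl, of "\<lambda>x. \<Phi> (1 - x)" \<Phi> "1/2" _ _, OF _ refl] by simp
  from DERIV_unique[OF der this] have "deriv \<Phi> (1/2) = deriv \<Phi> (1/2) * (-1)" by simp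
  then show half: "- deriv \<Phi> (1/2) = 0" by simp
  show "0 \<le> - deriv \<Phi> x" if "0 < x" "x \<le> 1/2" for x
    using mono_onD[OF mono_deriv, of x "1/2"] half that by simp
  show "convex_on {0<..1/2} (\<lambda>x. - deriv \<Phi> x)"
  proof (rule convex_onI)
    fix t x y :: real
    assume "0 < t" "t < 1" "x \<in> {0<..1/2}" "y \<in> {0<..1/2}"
    then show "- deriv \<Phi> ((1 - t) *\<^sub>R x + t *\<^sub>R y) \<le> (1 - t) * - deriv \<Phi> x + t * - deriv \<Phi> y"
      using conc_deriv unfolding strictly_concave_on_def
      by (cases "x = y") (force simp: algebra_simps)+
  qed auto
qed (use sym cont in \<open>auto intro!: continuous_intros\<close>)

text \<open>\<open>bal\<close> and \<open>quad\<close> are linear in \<open>\<alpha> * u\<close> and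
  \<open>r * v\<close>; solving them gives exactly the formulas for \<open>pp\<close> and
  \<open>qq\<close>.\<close>

lemma Upsilon_bar_ge:
  fixes \<Phi> \<omega> :: "real \<Rightarrow> real"
  assumes sym: "\<forall>x\<in>{0..1}. \<Phi> (1 - x) = \<Phi> x"
    and max0: "\<And>h. 0 \<le> h \<Longrightarrow> h \<le> 1 \<Longrightarrow> \<Phi> h \<le> \<Phi> 0"
    and rho: "0 < \<rho>" "\<rho> < 1" and beta: "0 \<le> \<beta>" "\<beta> \<le> 1/2"
    and uv: "0 < u" "u \<le> 1/2" "0 < v" "v < 1" "u + v \<le> 1"
    and al: "0 \<le> \<alpha>" "\<alpha> \<le> 1/2 + \<beta>" and r: "0 \<le> r" "r \<le> 1/2 - \<beta>"
    and bal: "\<alpha> * u - r * v = (1 - \<rho>) * \<beta>"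
    and quad: "\<alpha> * u * (2 - 2 * u - \<rho>\<^sup>2) + r * v * (2 - 2 * v - \<rho>\<^sup>2)
      = (1 - \<rho>) * (1 + \<rho> - 4 * \<rho>\<^sup>2 * \<omega> \<beta>) / 2"
  shows "\<Phi> 0 - (\<alpha> * (\<Phi> 0 - \<Phi> u) + r * (\<Phi> 0 - \<Phi> v)) \<le> Upsilon_bar \<rho> \<Phi> \<omega>"
proof -
  define z1 z2 where "z1 = (u - 1/2) / \<rho>" and "z2 = (1/2 - v) / \<rho>"
  have z: "\<rho> * z1 = u - 1/2" "\<rho> * z2 = 1/2 - v" using rho by (auto simp: z1_def z2_def)
  define d where "d = 2 - u - v - \<rho>\<^sup>2"
  have rho2: "\<rho>\<^sup>2 < 1" using rho by (simp add: power_less_one_iff)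
  have d: "0 < d" using uv rho2 by (simp add: d_def)
  have den: "1 + 2 * \<rho> * z1 = 2 * u" "1 - 2 * \<rho> * z2 = 2 * v" "1 + \<rho> * z2 - \<rho> * z1 - \<rho>\<^sup>2 = d"
    using z by (auto simp: d_def)
  have num: "1 + 2 * \<rho> * z2 - \<rho>\<^sup>2 = 2 - 2 * v - \<rho>\<^sup>2" "1 - 2 * \<rho> * z1 - \<rho>\<^sup>2 = 2 - 2 * u - \<rho>\<^sup>2"
    using z by auto
  define Q where "Q = \<alpha> * u * (2 - 2 * u - \<rho>\<^sup>2) + r * v * (2 - 2 * v - \<rho>\<^sup>2)"
  have Q: "(1 - \<rho>) * (1 + \<rho> - 4 * \<rho>\<^sup>2 * \<omega> \<beta>) = 2 * Q" using quad by (simp add: Q_def)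
  have "(1 - \<rho>) * (1 + \<rho> - 4 * \<rho>\<^sup>2 * \<omega> \<beta> + 2 * \<beta> * (2 - 2 * v - \<rho>\<^sup>2))
      = 2 * Q + 2 * ((1 - \<rho>) * \<beta>) * (2 - 2 * v - \<rho>\<^sup>2)"
    unfolding Q[symmetric] by (simp add: algebra_simps)
  also have "\<dots> = 4 * (\<alpha> * u * d)"
    unfolding Q_def bal[symmetric] d_def by (simp add: algebra_simps)
  finally have p: "pp \<rho> (\<omega> \<beta>) \<beta> z1 z2 = \<alpha> / 2"
    unfolding pp_def den num using uv d by (simp add: field_simps)
  have "(1 - \<rho>) * (1 + \<rho> - 4 * \<rho>\<^sup>2 * \<omega> \<beta> - 2 * \<beta> * (2 - 2 * u - \<rho>\<^sup>2))
      = 2 * Q - 2 * ((1 - \<rho>) * \<beta>) * (2 - 2 * u - \<rho>\<^sup>2)"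
    unfolding Q[symmetric] by (simp add: algebra_simps)
  also have "\<dots> = 4 * (r * v * d)"
    unfolding Q_def bal[symmetric] d_def by (simp add: algebra_simps)
  finally have q: "qq \<rho> (\<omega> \<beta>) \<beta> z1 z2 = r / 2"
    unfolding qq_def den num using uv d by (simp add: field_simps)
  have "- 1 / (2 * \<rho>) \<le> z1" "z2 \<le> 1 / (2 * \<rho>)"
    using uv rho by (auto simp: z1_def z2_def field_simps)
  moreover have "z1 \<le> z2" unfolding z1_def z2_def using uv rho by (intro divide_right_mono) auto
  ultimately have "(z1, z2) \<in> Zcheck \<rho> (\<omega> \<beta>) \<beta>"
    unfolding Zcheck_def using p q den d uv al r by auto
  moreover have "\<Phi> 0 - (\<alpha> * (\<Phi> 0 - \<Phi> u) + r * (\<Phi> 0 - \<Phi> v))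
      = (1 - 2 * pp \<rho> (\<omega> \<beta>) \<beta> z1 z2 - 2 * qq \<rho> (\<omega> \<beta>) \<beta> z1 z2) * \<Phi> 0
          + 2 * pp \<rho> (\<omega> \<beta>) \<beta> z1 z2 * \<Phi> (1/2 + \<rho> * z1)
          + 2 * qq \<rho> (\<omega> \<beta>) \<beta> z1 z2 * \<Phi> (1/2 + \<rho> * z2)"
  proof -
    have "\<Phi> (1/2 + \<rho> * z1) = \<Phi> u" "\<Phi> (1/2 + \<rho> * z2) = \<Phi> v" using z sym uv by simp_all
    then show ?thesis unfolding p q by (simp add: algebra_simps)
  qed
  ultimately have mem: "\<Phi> 0 - (\<alpha> * (\<Phi> 0 - \<Phi> u) + r * (\<Phi> 0 - \<Phi> v)) \<in>
      {(1 - 2 * pp \<rho> (\<omega> \<beta>) \<beta> z1 z2 - 2 * qq \<rho> (\<omega> \<beta>) \<beta> z1 z2) * \<Phi> 0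
          + 2 * pp \<rho> (\<omega> \<beta>) \<beta> z1 z2 * \<Phi> (1/2 + \<rho> * z1)
          + 2 * qq \<rho> (\<omega> \<beta>) \<beta> z1 z2 * \<Phi> (1/2 + \<rho> * z2)
        | \<beta> z1 z2. \<beta> \<in> {0..1/2} \<and> (z1, z2) \<in> Zcheck \<rho> (\<omega> \<beta>) \<beta>}"
    using beta by (intro CollectI) (metis atLeastAtMost_iff)
  show ?thesis
    unfolding Upsilon_bar_def
  \<comment> \<open>The supremum needs a bounded set: \<Phi> is largest at 0 and both weights are
    nonnegative, so \<open>\<Phi> 0\<close> is a bound.\<close>
  proof (rule cSup_upper[OF mem], rule bdd_aboveI[of _ "\<Phi> 0"], clarify)
    fix \<beta> z1 z2 assume "\<beta> \<in> {0..1/2}" and Z: "(z1, z2) \<in> Zcheck \<rho> (\<omega> \<beta>) \<beta>"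
    define p q where "p = pp \<rho> (\<omega> \<beta>) \<beta> z1 z2" and "q = qq \<rho> (\<omega> \<beta>) \<beta> z1 z2"
    have zz: "- 1 / (2 * \<rho>) \<le> z1" "z1 \<le> z2" "z2 \<le> 1 / (2 * \<rho>)" and pq: "0 \<le> p" "0 \<le> q"
      using Z by (auto simp: Zcheck_def p_def q_def)
    have "0 \<le> 1/2 + \<rho> * z1" "1/2 + \<rho> * z2 \<le> 1" using zz rho by (auto simp: field_simps)
    moreover have "\<rho> * z1 \<le> \<rho> * z2" using zz rho by simp
    ultimately have "\<Phi> (1/2 + \<rho> * z1) \<le> \<Phi> 0" "\<Phi> (1/2 + \<rho> * z2) \<le> \<Phi> 0"
      by (auto intro!: max0)
    then have "2 * p * \<Phi> (1/2 + \<rho> * z1) \<le> 2 * p * \<Phi> 0" "2 * q * \<Phi> (1/2 + \<rho> * z2) \<le> 2 * q * \<Phi> 0"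
      using pq by (auto intro!: mult_left_mono)
    then show "(1 - 2 * pp \<rho> (\<omega> \<beta>) \<beta> z1 z2 - 2 * qq \<rho> (\<omega> \<beta>) \<beta> z1 z2) * \<Phi> 0
          + 2 * pp \<rho> (\<omega> \<beta>) \<beta> z1 z2 * \<Phi> (1/2 + \<rho> * z1)
          + 2 * qq \<rho> (\<omega> \<beta>) \<beta> z1 z2 * \<Phi> (1/2 + \<rho> * z2) \<le> \<Phi> 0"
      unfolding p_def[symmetric] q_def[symmetric] by (simp add: algebra_simps)
  qed
qed

section \<open>From Boolean functions to the two-cell problem\<close>

lemma finite_boolfuns [simp]: "finite (boolfuns n)"
  unfolding boolfuns_def by (intro finite_PiE) auto

lemma W1_le_W: "f \<in> Wset n a \<beta> \<Longrightarrow> W1 n f \<le> W n a \<beta>"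
  unfolding W_def Wset_def by (intro Max_ge) auto

lemma stability_bound:
  fixes \<Phi> \<omega> :: "real \<Rightarrow> real"
  assumes reflect: "\<forall>x\<in>{0..1}. \<Phi> (1 - x) = \<Phi> x"
    and loss: "loss (\<lambda>h. \<Phi> 0 - \<Phi> h)"
    and omega_le: "\<forall>\<beta>\<in>{0..1/2}. \<omega> \<beta> \<le> 1/4"
    and W_le: "\<forall>\<beta>\<in>{0..1/2}. Wset n (1/2) \<beta> \<noteq> {} \<longrightarrow> W n (1/2) \<beta> \<le> \<omega> \<beta>"
    and rho: "0 < \<rho>" "\<rho> < 1" and n: "n \<ge> 1"
    and f: "f \<in> boolfuns n" and mean: "Ex n f = 1/2"
  shows "Ex n (\<lambda>x. \<Phi> (noise_op n \<rho> f x)) \<le> Upsilon_bar \<rho> \<Phi> \<omega>"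
proof -
  interpret loss "\<lambda>h. \<Phi> 0 - \<Phi> h" by (rule loss)
  have f01: "f x = 0 \<or> f x = 1" if "x \<in> cube n" for x
    using f that by (auto simp: boolfuns_def PiE_iff)
  define \<beta> where "\<beta> = maxcoef n f"
  have fin: "finite {\<bar>fhat1 n f i\<bar> |i. i < n}" and ne: "{\<bar>fhat1 n f i\<bar> |i. i < n} \<noteq> {}"
    using n by (auto intro: exI[of _ 0])
  obtain i where i: "i < n" "\<beta> = \<bar>fhat1 n f i\<bar>"
    using Max_in[OF fin ne] unfolding \<beta>_def maxcoef_def by auto
  \<comment> \<open>The sign turns the largest coefficient into its absolute value, so
    \<open>y\<close> correlates nonnegatively with \<open>f\<close>.\<close>
  define s where "s = (if 0 \<le> fhat1 n f i then 1 else - 1 :: real)"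
  have s: "s = 1 \<or> s = -1" "\<beta> = s * fhat1 n f i" using i by (auto simp: s_def)
  define y where "y x = s * x i" for x :: "nat \<Rightarrow> real"
  have y: "y x = 1 \<or> y x = -1" if "x \<in> cube n" for x
    using cube_coord[OF that i(1)] s(1) by (auto simp: y_def)
  have "\<beta> = Ex n (\<lambda>x. s * (f x * x i))" unfolding s(2) fhat1_def Ex_cmult ..
  then have fy: "Ex n (\<lambda>x. f x * y x) = \<beta>" by (simp add: y_def mult_ac)
  have beta: "0 \<le> \<beta>" "\<beta> \<le> 1/2"
  proof -
    show "0 \<le> \<beta>" using i by simp
    have "Ex n (\<lambda>x. f x * y x) \<le> Ex n f"
    proof (rule Ex_mono)
      fix x assume "x \<in> cube n"
      then show "f x * y x \<le> f x" using f01[of x] y[of x] by auto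
    qed
    then show "\<beta> \<le> 1/2" using fy mean by simp
  qed
  have W1: "W1 n f \<le> \<omega> \<beta>"
  proof -
    have "f \<in> Wset n (1/2) \<beta>" using f mean by (simp add: Wset_def \<beta>_def)
    then show ?thesis using W1_le_W[of f n "1/2" \<beta>] W_le beta by force
  qed
  define g where "g = noise_op n \<rho> f"
  have g: "0 \<le> g x \<and> g x \<le> 1" if "x \<in> cube n" for x
    unfolding g_def using noise_op_range[of n f x \<rho>] f01 that rho by fastforce
  have Ey: "Ex n y = 0"
    using char_fun_orthonormal[of "{i}" n "{}"] i Ex_cmult[of n s "\<lambda>x. x i"]
    by (simp add: char_fun_def y_def[abs_def])
  have Eg: "Ex n g = 1/2"
    using fcoef_noise_op[of "{}" n \<rho> f] mean by (simp add: fcoef_empty g_def)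
  have gy: "Ex n (\<lambda>x. g x * y x) = \<rho> * \<beta>"
  proof -
    have "Ex n (\<lambda>x. g x * x i) = \<rho> * fhat1 n f i"
      using fcoef_noise_op[of "{i}" n \<rho> f] i by (simp add: fcoef_singleton g_def fhat1_def)
    then show ?thesis
      using Ex_cmult[of n s "\<lambda>x. g x * x i"] s(2) by (simp add: y_def mult_ac)
  qed
  define h where "h x = \<bar>f x - g x\<bar>" for x
  have h: "0 \<le> h x \<and> h x \<le> 1" if "x \<in> cube n" for x
    using f01[OF that] g[OF that] by (auto simp: h_def)
  have \<Phi>h: "\<Phi> (g x) = \<Phi> (h x)" if "x \<in> cube n" for x
    using f01[OF that] g[OF that] reflect by (auto simp: h_def)
  define I where "I = {x \<in> cube n. (2 * f x - 1) * y x = 1}"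
  define J where "J = cube n - I"
  define k where "k = (\<lambda>x :: nat \<Rightarrow> real. 1 / 2 ^ n :: real)"
  have split: "(\<Sum>x\<in>I. k x * F x) + (\<Sum>x\<in>J. k x * F x) = Ex n F" for F
  proof -
    have "sum F (cube n) = sum F J + sum F I"
      unfolding J_def by (rule sum.subset_diff) (auto simp: I_def)
    then show ?thesis by (simp add: Ex_def k_def sum_divide_distrib[symmetric] add_divide_distrib)
  qed
  have J: "(2 * f x - 1) * y x = -1" if "x \<in> J" for x
    using that f01[of x] y[of x] by (auto simp: I_def J_def)
  have I: "(2 * f x - 1) * y x = 1" if "x \<in> I" for x using that by (simp add: I_def)
  have signed: "(\<Sum>x\<in>I. k x * F x) - (\<Sum>x\<in>J. k x * F x) = Ex n (\<lambda>x. (2 * f x - 1) * y x * F x)" for F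
    unfolding split[symmetric] using I J by (simp add: sum_negf)
  have tot: "sum k I + sum k J = 1" using split[of "\<lambda>_. 1"] Ex_const[of n 1] by simp
  have "sum k I - sum k J = 2 * \<beta>"
  proof -
    have "Ex n (\<lambda>x. (2 * f x - 1) * y x * 1) = Ex n (\<lambda>x. 2 * (f x * y x) - y x)"
      by (simp add: algebra_simps)
    also have "\<dots> = 2 * \<beta>" unfolding Ex_diff Ex_cmult fy Ey by simp
    finally show ?thesis using signed[of "\<lambda>_. 1"] by simp
  qed
  with tot have PI: "sum k I = 1/2 + \<beta>" and PJ: "sum k J = 1/2 - \<beta>" by auto
  define C where "C = (1 - \<rho>) * (1 + \<rho> - 4 * \<rho>\<^sup>2 * \<omega> \<beta>) / 2"
  interpret two_cell "\<lambda>h. \<Phi> 0 - \<Phi> h" \<rho> \<beta> C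
  proof
    have "\<rho>\<^sup>2 * (4 * \<omega> \<beta>) \<le> \<rho>\<^sup>2 * 1" using omega_le[rule_format, of \<beta>] beta by (intro mult_left_mono) auto
    then show "(1 - \<rho>) * (1 + \<rho> - \<rho>\<^sup>2) / 2 \<le> C"
      unfolding C_def using rho by (intro divide_right_mono mult_left_mono) auto
  qed (use rho beta in auto)
  have bal: "(\<Sum>x\<in>I. k x * h x) - (\<Sum>x\<in>J. k x * h x) = drift"
  proof -
    \<comment> \<open>For Boolean \<open>f\<close>, the factor \<open>2 * f x - 1\<close> restores
      the sign of \<open>f x - g x\<close>.\<close>
    have "Ex n (\<lambda>x. (2 * f x - 1) * y x * h x) = Ex n (\<lambda>x. f x * y x - g x * y x)"
    proof (rule Ex_cong)
      fix x assume "x \<in> cube n"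
      then show "(2 * f x - 1) * y x * h x = f x * y x - g x * y x"
        using f01[of x] g[of x] by (auto simp: h_def algebra_simps)
    qed
    then show ?thesis unfolding signed Ex_diff fy gy drift_def by (simp add: algebra_simps)
  qed
  have quad: "C \<le> 2 * ((\<Sum>x\<in>I. k x * (h x * (1 - h x))) + (\<Sum>x\<in>J. k x * (h x * (1 - h x))))
      - \<rho>\<^sup>2 * ((\<Sum>x\<in>I. k x * h x) + (\<Sum>x\<in>J. k x * h x))"
  proof -
    have "Ex n (\<lambda>x. h x * (1 - h x)) = Ex n (\<lambda>x. g x - (g x)\<^sup>2)"
    proof (rule Ex_cong)
      fix x assume "x \<in> cube n"
      then show "h x * (1 - h x) = g x - (g x)\<^sup>2"
        using f01[of x] g[of x] by (auto simp: h_def algebra_simps power2_eq_square)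
    qed
    then have e: "Ex n (\<lambda>x. h x * (1 - h x)) = 1/2 - Ex n (\<lambda>x. (g x)\<^sup>2)"
      unfolding Ex_diff Eg .
    have "Ex n h = Ex n (\<lambda>x. f x + g x - 2 * (f x * g x))"
    proof (rule Ex_cong)
      fix x assume "x \<in> cube n"
      then show "h x = f x + g x - 2 * (f x * g x)"
        using f01[of x] g[of x] by (auto simp: h_def)
    qed
    then have m: "Ex n h = 1 - 2 * Ex n (\<lambda>x. f x * g x)"
      unfolding Ex_diff Ex_add Ex_cmult Eg mean by simp
    have "(1 - \<rho>) * \<rho>\<^sup>2 * W1 n f \<le> (1 - \<rho>) * \<rho>\<^sup>2 * \<omega> \<beta>"
      using W1 rho by (intro mult_left_mono) auto
    then show ?thesis
      using noise_moment_bound[OF rho, of n f]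
      unfolding split e m C_def g_def[symmetric] mean
      by (simp add: field_simps power2_eq_square)
  qed
  have "feasible ((\<Sum>x\<in>I. k x * (\<Phi> 0 - \<Phi> (h x))) + (\<Sum>x\<in>J. k x * (\<Phi> 0 - \<Phi> (h x))))"
  proof (rule feasible_of_moments[OF _ _ _ _ PI PJ bal quad])
    show "0 \<le> h x \<and> h x \<le> 1" if "x \<in> I \<union> J" for x
      using that h by (auto simp: I_def J_def)
  qed (auto simp: I_def J_def k_def)
  moreover have "(\<Sum>x\<in>I. k x * (\<Phi> 0 - \<Phi> (h x))) + (\<Sum>x\<in>J. k x * (\<Phi> 0 - \<Phi> (h x)))
      = \<Phi> 0 - Ex n (\<lambda>x. \<Phi> (g x))"
    unfolding split Ex_diff Ex_const using Ex_cong[of n "\<lambda>x. \<Phi> (g x)" "\<lambda>x. \<Phi> (h x)"] \<Phi>h by simp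
  ultimately have "feasible (\<Phi> 0 - Ex n (\<lambda>x. \<Phi> (g x)))" by simp
  then obtain u v \<alpha> r where F: "0 < u" "u \<le> 1/2" "0 < v" "v < 1" "u + v \<le> 1"
    "0 \<le> \<alpha>" "\<alpha> \<le> 1/2 + \<beta>" "0 \<le> r" "r \<le> 1/2 - \<beta>" "\<alpha> * u - r * v = drift"
    "C = \<alpha> * u * (2 - 2 * u - \<rho>\<^sup>2) + r * v * (2 - 2 * v - \<rho>\<^sup>2)"
    "\<alpha> * (\<Phi> 0 - \<Phi> u) + r * (\<Phi> 0 - \<Phi> v) \<le> \<Phi> 0 - Ex n (\<lambda>x. \<Phi> (g x))"
    by (rule feasible_tight)
  have "\<Phi> 0 - (\<alpha> * (\<Phi> 0 - \<Phi> u) + r * (\<Phi> 0 - \<Phi> v)) \<le> Upsilon_bar \<rho> \<Phi> \<omega>"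
    using nonneg
    by (intro Upsilon_bar_ge[where \<omega> = \<omega>, OF reflect _ rho beta F(1-9) F(10)[unfolded drift_def]
          F(11)[unfolded C_def, symmetric]]) auto
  then show ?thesis using F(12) unfolding g_def by simp
qed

theorem theorem3p6:
  fixes \<Phi> \<omega> :: "real \<Rightarrow> real" and \<rho> :: real and n :: nat
  assumes sym: "\<forall>x\<in>{0..1}. \<Phi> (1 - x) = \<Phi> x"
    and cont: "continuous_on {0..1} \<Phi>"
    and diff: "\<Phi> differentiable_on {0<..<1}"
    and mono_deriv: "mono_on {0<..<1} (deriv \<Phi>)"
    and cont_deriv: "continuous_on {0<..<1} (deriv \<Phi>)"
    and conc_deriv: "strictly_concave_on {0<..1/2} (deriv \<Phi>)"
    and cont_omega: "continuous_on {0..1/2} \<omega>"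
    and omega_le: "\<forall>\<beta>\<in>{0..1/2}. \<omega> \<beta> \<le> 1/4"
    and W_le: "\<forall>\<beta>\<in>{0..1/2}. Wset n (1/2) \<beta> \<noteq> {} \<longrightarrow> W n (1/2) \<beta> \<le> \<omega> \<beta>"
    and rho: "0 < \<rho>" "\<rho> < 1"
    and n: "n \<ge> 1"
  shows "MaxStab n \<rho> \<Phi> (1/2) \<le> Upsilon_bar \<rho> \<Phi> \<omega>"
proof -
  define S where "S = {Ex n (\<lambda>x. \<Phi> (noise_op n \<rho> f x)) | f. f \<in> boolfuns n \<and> Ex n f = 1/2}"
  have "S = (\<lambda>f. Ex n (\<lambda>x. \<Phi> (noise_op n \<rho> f x))) ` {f \<in> boolfuns n. Ex n f = 1/2}"
    by (auto simp: S_def)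
  then have fin: "finite S" by simp
  \<comment> \<open>A dictator function has mean 1/2, so the maximum is over a nonempty set.\<close>
  define f0 where "f0 = restrict (\<lambda>x. (1 + x 0) / 2) (cube n)"
  have "f0 \<in> boolfuns n"
    using cube_coord[of _ n 0] n by (fastforce simp: boolfuns_def f0_def)
  moreover have "Ex n f0 = 1/2"
  proof -
    have "Ex n f0 = Ex n (\<lambda>x. 1/2 + 1/2 * x 0)"
      by (rule Ex_cong) (simp add: f0_def field_simps)
    also have "\<dots> = 1/2 + 1/2 * Ex n (\<lambda>x. x 0)" by (simp only: Ex_add Ex_cmult Ex_const)
    also have "Ex n (\<lambda>x. x 0) = 0"
      using char_fun_orthonormal[of "{0}" n "{}"] n by (simp add: char_fun_def)
    finally show ?thesis by simp
  qed
  ultimately have ne: "S \<noteq> {}" by (auto simp: S_def)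
  have "\<forall>t\<in>S. t \<le> Upsilon_bar \<rho> \<Phi> \<omega>"
    using stability_bound[OF sym loss_of_Phi[OF sym cont diff mono_deriv conc_deriv] omega_le W_le rho n]
    by (auto simp: S_def)
  then show ?thesis
    unfolding MaxStab_def S_def[symmetric] using Max.bounded_iff[OF fin ne] by simp
qed

end
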